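(* Let $H$ be a $\mathcal{PH}$-graph, let $F_1,\ldots,F_t\subseteq V_{\mathcal H}(H)$ ($t\ge1$), let $G=H\square_{F_1,\ldots,F_t}K_2^{\square t}$ and let $(G,p,\ell)$ be a point-hyperplane framework in $\mathbb{R}^d$ with $t$-fold extrusion symmetry. Let $\Gamma=\mathbb{Z}_2^t$ and $r=2^t$. Suppose there is no edge $\{i,j\}\in E_{\mathcal{PH}}$ (with $i\in V_{\mathcal P}$, $j\in V_{\mathcal H}$) where the hyperplane corresponding to $j$ contains an extrusion direction. Then there exist non-singular matrices $A$ and $B$ such that $B^{\top}R(G,p,\ell)A$ is block-decomposed as $$B^{\top}R(G,p,\ell)A=\widetilde R(G,p,\ell)=\begin{pmatrix}\widetilde R_0(G,p,\ell)& &\mathbf 0\\ &\ddots& \\ \mathbf 0& &\widetilde R_{r-1}(G,p,\ell)\end{pmatrix},$$ where the submatrix block $\widetilde R_i(G,p,\ell)$ corresponds to the $i$-th irreducible representation $\rho_i$ of $\Gamma$.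
   Context: **Frameworks.** A $\mathcal{PH}$-graph is a finite simple graph $G=(V_{\mathcal P}\cup V_{\mathcal H},E)$ with vertex set partitioned into non-empty sets $V_{\mathcal P},V_{\mathcal H}$; $E$ is partitioned into $E_{\mathcal{PP}},E_{\mathcal{PH}},E_{\mathcal{HH}}$ according to the types of the end-vertices. A point-hyperplane framework $(G,p,\ell)$ in $\mathbb{R}^d$ has maps $p:V_{\mathcal P}\to\mathbb{R}^d$ and $\ell=(a,r):V_{\mathcal H}\to(\mathbb{R}^d\setminus\{0\})\times\mathbb{R}$; vertex $j\in V_{\mathcal H}$ represents the hyperplane $\{x:\langle a_j,x\rangle=r_j\}$, which contains a direction $\tau$ if $\langle a_j,\tau\rangle=0$. $E_{\mathcal{HH}}$ is split into $E_{\mathcal{HH}\parallel}$ (edges whose two hyperplanes are parallel) and $E_{\mathcal{HH}\not\parallel}$ (the others). **Graph.** $H\square K_2^{\square t}$ has vertices $(u,\mathbf e)$, $u\in V(H)$, $\mathbf e\in\{0,1\}^t$, and edges $\{(u,\mathbf e),(u',\mathbf e)\}$ for $\{u,u'\}\in E(H)$ and $\{(u,\mathbf e),(u,\mathbf e')\}$ for $\mathbf e,\mathbf e'$ differing in exactly one entry. $G=H\square_{F_1,\ldots,F_t}K_2^{\square t}$ is obtained from it by contracting, for $h=1,\dots,t$ and $w\in F_h$, all pairs $(w,\mathbf e),(w,\mathbf e')$ with $\mathbf e,\mathbf e'$ differing only in the $h$-th entry to one vertex, whose $h$-th entry is then written $\star$; edges between contracted vertices are removed (and multiple edges are identified). So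 its vertices are $(u,\mathbf e)$ with $\mathbf e\in\{0,1,\star\}^t$, where $\mathbf e_h=\star$ iff $u\in F_h$. A vertex $(u,\mathbf e)$ is in $V_{\mathcal P}$ (resp. $V_{\mathcal H}$) iff $u\in V_{\mathcal P}(H)$ (resp. $V_{\mathcal H}(H)$). $\Gamma$ acts on $G$ by the extrusion action $\theta(\gamma)(u,\mathbf e)=(u,\mathbf e+\gamma)$, addition mod 2 with $\star+0=\star+1=\star$; write $\gamma i$ for $\theta(\gamma)(i)$ and $\gamma e$ for the induced action on edges. **Extrusion symmetry.** For a vertex $i=(u,\mathbf e)$ and $\gamma\in\Gamma$ put $\tau_\gamma(i)=\sum_{h\in X}\tau_h-\sum_{g\in Y}\tau_g$, where $X=\{h:\mathbf e_h=0,\gamma_h=1\}$ and $Y=\{g:\mathbf e_g=1,\gamma_g=1\}$. $(G,p,\ell)$ has $t$-fold extrusion symmetry if there are $\tau_1,\ldots,\tau_t\in\mathbb{R}^d\setminus\{0\}$ (its extrusion directions) such that for all $\gamma\in\Gamma$: (i) $p_{\gamma i}=p_i+\tau_\gamma(i)$ for $i\in V_{\mathcal P}$; (ii) $a_{\gamma j}=a_j$ for $j\in V_{\mathcal H}$; (iii) $\langle\tau_h,a_{(w,\mathbf e)}\rangle=0$ for $(w,\mathbf e)\in V_{\mathcal H}$ whenever $w\in F_h$; (iv) $r_{\gamma j}=r_j+\langle a_j,\tau_\gamma(j)\rangle$ for $j\in V_{\mathcal H}$. **Rigidity matrix.** $R(G,p,\ell)$ has $d$ columns for each $i\in V_{\mathcal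 P}$ (variables $\dot p_i$) and $d+1$ columns for each $j\in V_{\mathcal H}$ (variables $\dot\ell_j=(\dot a_j,\dot r_j)$). Its rows, in this order, with entries zero where not specified, are: for $\{i,j\}\in E_{\mathcal{PP}}$: $p_i-p_j$ under $i$ and $p_j-p_i$ under $j$; for $\{i,k\}\in E_{\mathcal{PH}}$: $a_k$ under $i$ and $(p_i,-1)$ under $k$; for $\{k,l\}\in E_{\mathcal{HH}\not\parallel}$: $(a_l,0)$ under $k$ and $(a_k,0)$ under $l$; for $\{k,l\}\in E_{\mathcal{HH}\parallel}$: $d-1$ rows, the $m$-th being $(c\,\alpha_m,0)$ under $k$ and $(-\alpha_m,0)$ under $l$, where $a_l=c\,a_k$ and $\alpha_1,\ldots,\alpha_{d-1}$ is a basis of the orthogonal complement of $a_k$ in $\mathbb{R}^d$; for each $k\in V_{\mathcal H}$: $(a_k,0)$ under $k$. Conventions for parallel edges: for $\{(w,\mathbf e),(w,\mathbf e')\}$ with $\mathbf e_h=0$, $\mathbf e'_h=1$, take $k=(w,\mathbf e)$, $l=(w,\mathbf e')$ (here $c=1$); for edges whose end-vertices lie over distinct vertices of $H$, the vertex taken as $k$ lies over the same vertex of $H$ for all edges of a $\Gamma$-orbit; and the same vectors $\alpha_m$ are used for all edges in a $\Gamma$-orbit. **Representations.** $P_S$ denotes the permutation representation of $\Gamma$ on a set $S$, with $P_S(\gamma)=[\delta_{x,\gamma y}]_{x,y\in S}$. The internal representation is $P'_E=P'_{E_{\mathcal{PP}}}\oplus P_{E_{\mathcal{PH}}}\oplus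 P_{E_{\mathcal{HH}\not\parallel}}\oplus(P'_{E_{\mathcal{HH}\parallel}}\otimes I_{d-1})\oplus P_{V_{\mathcal H}}$. Here $P'_{E_{\mathcal{PP}}}$ and $P'_{E_{\mathcal{HH}\parallel}}$ are obtained from $P_{E_{\mathcal{PP}}}$ and $P_{E_{\mathcal{HH}\parallel}}$ as follows: for each $\gamma$ and each edge $e=\{(u,\mathbf e),(u,\mathbf e')\}$ with $\mathbf e,\mathbf e'$ differing exactly in the $h$-th entry, with $f=\gamma e$, the $1$ in the $(e,f)$ and $(f,e)$ entries is replaced by $-1$ iff $\gamma_h=1$. The external representation is $P'_V=(P_{V_{\mathcal P}}\otimes I_d)\oplus P'_{V_{\mathcal H}}$ on $\mathbb{R}^{d|V_{\mathcal P}|+(d+1)|V_{\mathcal H}|}$, where $P'_{V_{\mathcal H}}(\gamma)$ is obtained from $P_{V_{\mathcal H}}(\gamma)=[\delta_{i,\gamma j}]_{i,j}$ by replacing each $0$ by the $(d+1)\times(d+1)$ zero matrix and each $1$ in entry $(i,j)$ by $\begin{pmatrix}I_d&\mathbf 0\\-\tau_\gamma(i)^T&1\end{pmatrix}$. The $r=2^t$ irreducible representations of $\Gamma$ are $\rho_\gamma(\gamma')=(-1)^{x_1'x_1+\dots+x_t'x_t}$ for $\gamma=(x_1,\ldots,x_t)$, $\gamma'=(x_1',\ldots,x_t')$, enumerated $\rho_0,\ldots,\rho_{r-1}$. Let $X^{(\rho_\kappa)}$ and $Y^{(\rho_\kappa)}$ be the subspaces of vectors on which every $\gamma$ acts, through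 $P'_V$ resp. $P'_E$, as multiplication by $\rho_\kappa(\gamma)$. That the block $\widetilde R_\kappa$ corresponds to $\rho_\kappa$ means that its columns are indexed by those columns of $A$ which form a basis of $X^{(\rho_\kappa)}$ and its rows by those columns of $B$ which form a basis of $Y^{(\rho_\kappa)}$ (blocks need not be square and may be empty). *)

theory Defs
  imports "HOL-Library.Z2" "Jordan_Normal_Form.VS_Connect"
begin

section \<open>Graphs and extrusions\<close>

record 'v ph_graph =
  points :: "'v set"
  hyps :: "'v set"
  edges :: "'v set set"

definition verts :: "'v ph_graph \<Rightarrow> 'v set" where
  "verts G = points G \<union> hyps G"

definition ph_graph :: "'v ph_graph \<Rightarrow> bool" where
  "ph_graph G \<longleftrightarrow> finite (points G) \<and> finite (hyps G) \<and>
     points G \<noteq> {} \<and> hyps G \<noteq> {} \<and> points G \<inter> hyps G = {} \<and>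
     (\<forall>e\<in>edges G. \<exists>u v. e = {u, v} \<and> u \<noteq> v \<and> u \<in> verts G \<and> v \<in> verts G)"

definition edges_PP :: "'v ph_graph \<Rightarrow> 'v set set" where
  "edges_PP G = {e \<in> edges G. e \<subseteq> points G}"

definition edges_PH :: "'v ph_graph \<Rightarrow> 'v set set" where
  "edges_PH G = {e \<in> edges G. e \<inter> points G \<noteq> {} \<and> e \<inter> hyps G \<noteq> {}}"

definition edges_HH :: "'v ph_graph \<Rightarrow> 'v set set" where
  "edges_HH G = {e \<in> edges G. e \<subseteq> hyps G}"

definition other_end :: "'v set \<Rightarrow> 'v \<Rightarrow> 'v" where
  "other_end e i = the_elem (e - {i})"

text \<open>The set \<open>bits t\<close> serves both as the vertex set of the hypercube and as the group
  $\Gamma = \mathbb{Z}_2^t$. Coordinates are numbered from 0 to \<open>t - 1\<close>.\<close>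

definition bits :: "nat \<Rightarrow> bit list set" where
  "bits t = {x. length x = t}"

definition differ_exactly_at :: "nat \<Rightarrow> 'a list \<Rightarrow> 'a list \<Rightarrow> bool" where
  "differ_exactly_at h x y \<longleftrightarrow> length x = length y \<and> h < length x \<and>
     (\<forall>g < length x. x ! g \<noteq> y ! g \<longleftrightarrow> g = h)"

definition prism_edges :: "nat \<Rightarrow> 'v ph_graph \<Rightarrow> ('v \<times> bit list) set set" where
  "prism_edges t H =
     {{(u, x), (v, x)} | u v x. {u, v} \<in> edges H \<and> x \<in> bits t} \<union>
     {{(u, x), (u, y)} | u x y. u \<in> verts H \<and> x \<in> bits t \<and> y \<in> bits t \<and>
                                (\<exists>h<t. differ_exactly_at h x y)}"

text \<open>In a vertex \<open>(u, x)\<close> of the extrusion graph, the entry \<open>None\<close> stands for $\star$.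
  The map \<open>contract\<close> is the quotient map of the contraction; edges between identified vertices
  are mapped to singletons and are discarded.\<close>

type_synonym 'v evert = "'v \<times> bit option list"

definition contract :: "(nat \<Rightarrow> 'v set) \<Rightarrow> 'v \<times> bit list \<Rightarrow> 'v evert" where
  "contract F = (\<lambda>(u, x).
     (u, map (\<lambda>h. if u \<in> F h then None else Some (x ! h)) [0..<length x]))"

definition extrusion_graph ::
  "nat \<Rightarrow> (nat \<Rightarrow> 'v set) \<Rightarrow> 'v ph_graph \<Rightarrow> 'v evert ph_graph" where
  "extrusion_graph t F H =
     \<lparr> points = contract F ` (points H \<times> bits t),
       hyps = contract F ` (hyps H \<times> bits t),
       edges = {e \<in> (\<lambda>e'. contract F ` e') ` prism_edges t H. card e = 2} \<rparr>"

definition act :: "bit list \<Rightarrow> 'v evert \<Rightarrow> 'v evert" where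
  "act \<gamma> = (\<lambda>(u, x). (u, map2 (\<lambda>b g. map_option (\<lambda>c. c + g) b) x \<gamma>))"

definition extruded_edge :: "nat \<Rightarrow> 'v evert set \<Rightarrow> bool" where
  "extruded_edge h e \<longleftrightarrow> (\<exists>u x y. e = {(u, x), (u, y)} \<and> differ_exactly_at h x y)"

section \<open>Point-hyperplane frameworks\<close>

text \<open>A framework is given by the points \<open>p i\<close> and the hyperplanes
  $\{x \mid \langle a_j, x\rangle = r_j\}$. Every \<open>r j\<close> is a real number, so that
  \<open>r\<close> is not subject to any condition.\<close>

definition ph_framework ::
  "nat \<Rightarrow> 'v ph_graph \<Rightarrow> ('v \<Rightarrow> real vec) \<Rightarrow> ('v \<Rightarrow> real vec) \<Rightarrow> ('v \<Rightarrow> real) \<Rightarrow> bool" where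
  "ph_framework d G p a r \<longleftrightarrow>
     (\<forall>i\<in>points G. p i \<in> carrier_vec d) \<and>
     (\<forall>j\<in>hyps G. a j \<in> carrier_vec d \<and> a j \<noteq> 0\<^sub>v d)"

definition hyperplane_contains :: "real vec \<Rightarrow> real vec \<Rightarrow> bool" where
  "hyperplane_contains n \<tau> \<longleftrightarrow> n \<bullet> \<tau> = 0"

definition parallel :: "real vec \<Rightarrow> real vec \<Rightarrow> bool" where
  "parallel n n' \<longleftrightarrow> (\<exists>c. n' = c \<cdot>\<^sub>v n)"

definition edges_HH_par :: "'v ph_graph \<Rightarrow> ('v \<Rightarrow> real vec) \<Rightarrow> 'v set set" where
  "edges_HH_par G a = {e \<in> edges_HH G. \<forall>k\<in>e. \<forall>l\<in>e. parallel (a k) (a l)}"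

definition edges_HH_npar :: "'v ph_graph \<Rightarrow> ('v \<Rightarrow> real vec) \<Rightarrow> 'v set set" where
  "edges_HH_npar G a = edges_HH G - edges_HH_par G a"

definition shift :: "nat \<Rightarrow> (nat \<Rightarrow> real vec) \<Rightarrow> bit list \<Rightarrow> 'v evert \<Rightarrow> real vec" where
  "shift d \<tau> \<gamma> i =
     finsum_vec TYPE(real) d \<tau> {h. h < length \<gamma> \<and> snd i ! h = Some 0 \<and> \<gamma> ! h = 1} -
     finsum_vec TYPE(real) d \<tau> {g. g < length \<gamma> \<and> snd i ! g = Some 1 \<and> \<gamma> ! g = 1}"

definition extrusion_symmetric ::
  "nat \<Rightarrow> nat \<Rightarrow> (nat \<Rightarrow> 'v set) \<Rightarrow> 'v evert ph_graph \<Rightarrow>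
   ('v evert \<Rightarrow> real vec) \<Rightarrow> ('v evert \<Rightarrow> real vec) \<Rightarrow> ('v evert \<Rightarrow> real) \<Rightarrow>
   (nat \<Rightarrow> real vec) \<Rightarrow> bool" where
  "extrusion_symmetric d t F G p a r \<tau> \<longleftrightarrow>
     (\<forall>h<t. \<tau> h \<in> carrier_vec d \<and> \<tau> h \<noteq> 0\<^sub>v d) \<and>
     (\<forall>\<gamma>\<in>bits t.
        (\<forall>i\<in>points G. p (act \<gamma> i) = p i + shift d \<tau> \<gamma> i) \<and>
        (\<forall>j\<in>hyps G. a (act \<gamma> j) = a j) \<and>
        (\<forall>j\<in>hyps G. \<forall>h<t. fst j \<in> F h \<longrightarrow> \<tau> h \<bullet> a j = 0) \<and>
        (\<forall>j\<in>hyps G. r (act \<gamma> j) = r j + a j \<bullet> shift d \<tau> \<gamma> j))"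

section \<open>The rigidity matrix\<close>

definition basis_of :: "nat \<Rightarrow> real vec set \<Rightarrow> real vec list \<Rightarrow> bool" where
  "basis_of n W bs \<longleftrightarrow> distinct bs \<and> set bs \<subseteq> carrier_vec n \<and>
     \<not> LinearCombinations.module.lin_dep class_ring (module_vec TYPE(real) n) (set bs) \<and>
     LinearCombinations.module.span class_ring (module_vec TYPE(real) n) (set bs) = W"

text \<open>Rows and columns are named by labels. \<open>ColP i c\<close> with \<open>c < d\<close> is the \<open>c\<close>-th column of the
  point \<open>i\<close>; \<open>ColH k c\<close> with \<open>c < d + 1\<close> is the \<open>c\<close>-th column of the hyperplane \<open>k\<close>, where
  \<open>c = d\<close> belongs to the variable $\dot r_k$.\<close>

datatype 'v col_label = ColP 'v nat | ColH 'v nat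

datatype 'v row_label =
  RowPP "'v set" | RowPH "'v set" | RowNpar "'v set" | RowPar "'v set" nat | RowH 'v

definition col_labels :: "nat \<Rightarrow> 'v list \<Rightarrow> 'v list \<Rightarrow> 'v col_label list" where
  "col_labels d ps hs =
     [ColP i c. i \<leftarrow> ps, c \<leftarrow> [0..<d]] @ [ColH k c. k \<leftarrow> hs, c \<leftarrow> [0..<d + 1]]"

definition row_labels ::
  "nat \<Rightarrow> 'v set list \<Rightarrow> 'v set list \<Rightarrow> 'v set list \<Rightarrow> 'v set list \<Rightarrow> 'v list \<Rightarrow>
   'v row_label list" where
  "row_labels d pps phs npars pars hs =
     map RowPP pps @ map RowPH phs @ map RowNpar npars @
     [RowPar e m. e \<leftarrow> pars, m \<leftarrow> [0..<d - 1]] @ map RowH hs"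

text \<open>For a parallel edge \<open>e\<close>, \<open>tail e\<close> is the end-vertex that is taken as $k$ and
  \<open>\<alpha> e\<close> is the list $\alpha_1, \ldots, \alpha_{d-1}$.\<close>

definition parallel_convention ::
  "nat \<Rightarrow> nat \<Rightarrow> 'v evert ph_graph \<Rightarrow> ('v evert \<Rightarrow> real vec) \<Rightarrow>
   ('v evert set \<Rightarrow> 'v evert) \<Rightarrow> ('v evert set \<Rightarrow> real vec list) \<Rightarrow> bool" where
  "parallel_convention d t G a tail \<alpha> \<longleftrightarrow>
     (\<forall>e\<in>edges_HH_par G a.
        tail e \<in> e \<and>
        length (\<alpha> e) = d - 1 \<and>
        basis_of d {x \<in> carrier_vec d. a (tail e) \<bullet> x = 0} (\<alpha> e) \<and>
        (\<forall>h<t. extruded_edge h e \<longrightarrow> snd (tail e) ! h = Some 0) \<and>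
        (\<forall>\<gamma>\<in>bits t. card (fst ` e) = 2 \<longrightarrow> fst (tail (act \<gamma> ` e)) = fst (tail e)) \<and>
        (\<forall>\<gamma>\<in>bits t. \<alpha> (act \<gamma> ` e) = \<alpha> e))"

definition snoc_vec :: "real vec \<Rightarrow> real \<Rightarrow> real vec" where
  "snoc_vec x s = x @\<^sub>v vec_of_list [s]"

definition par_factor :: "('v \<Rightarrow> real vec) \<Rightarrow> 'v \<Rightarrow> 'v \<Rightarrow> real" where
  "par_factor a k l = (THE c. a l = c \<cdot>\<^sub>v a k)"

fun rigidity_entry ::
  "('v \<Rightarrow> real vec) \<Rightarrow> ('v \<Rightarrow> real vec) \<Rightarrow> ('v set \<Rightarrow> 'v) \<Rightarrow> ('v set \<Rightarrow> real vec list) \<Rightarrow>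
   'v row_label \<Rightarrow> 'v col_label \<Rightarrow> real" where
  "rigidity_entry p a tail \<alpha> (RowPP e) (ColP i c) =
     (if i \<in> e then (p i - p (other_end e i)) $ c else 0)"
| "rigidity_entry p a tail \<alpha> (RowPH e) (ColP i c) =
     (if i \<in> e then a (other_end e i) $ c else 0)"
| "rigidity_entry p a tail \<alpha> (RowPH e) (ColH k c) =
     (if k \<in> e then snoc_vec (p (other_end e k)) (-1) $ c else 0)"
| "rigidity_entry p a tail \<alpha> (RowNpar e) (ColH k c) =
     (if k \<in> e then snoc_vec (a (other_end e k)) 0 $ c else 0)"
| "rigidity_entry p a tail \<alpha> (RowPar e m) (ColH k c) =
     (let k' = tail e; l' = other_end e k' in
      if k = k' then snoc_vec (par_factor a k' l' \<cdot>\<^sub>v (\<alpha> e ! m)) 0 $ c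
      else if k = l' then snoc_vec (- (\<alpha> e ! m)) 0 $ c
      else 0)"
| "rigidity_entry p a tail \<alpha> (RowH k) (ColH l c) =
     (if l = k then snoc_vec (a k) 0 $ c else 0)"
| "rigidity_entry p a tail \<alpha> _ _ = 0"

definition mat_of_labels :: "('r \<Rightarrow> 'c \<Rightarrow> real) \<Rightarrow> 'r list \<Rightarrow> 'c list \<Rightarrow> real mat" where
  "mat_of_labels f rs cs = mat (length rs) (length cs) (\<lambda>(i, j). f (rs ! i) (cs ! j))"

section \<open>Representations of the extrusion group\<close>

text \<open>The internal representation, entrywise with respect to the row labels. An edge and its image
  under \<open>act \<gamma>\<close> are extruded in the same direction and \<open>act \<gamma>\<close> is an involution, so that the
  entries at $(e, f)$ and $(f, e)$ get the same sign. The rows \<open>RowPar e m\<close> realize the tensor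
  product with $I_{d-1}$.\<close>

definition edge_sign :: "bit list \<Rightarrow> 'v evert set \<Rightarrow> real" where
  "edge_sign \<gamma> e = (if \<exists>h < length \<gamma>. extruded_edge h e \<and> \<gamma> ! h = 1 then -1 else 1)"

fun int_rep_entry :: "bit list \<Rightarrow> 'v evert row_label \<Rightarrow> 'v evert row_label \<Rightarrow> real" where
  "int_rep_entry \<gamma> (RowPP e) (RowPP f) = (if e = act \<gamma> ` f then edge_sign \<gamma> e else 0)"
| "int_rep_entry \<gamma> (RowPH e) (RowPH f) = (if e = act \<gamma> ` f then 1 else 0)"
| "int_rep_entry \<gamma> (RowNpar e) (RowNpar f) = (if e = act \<gamma> ` f then 1 else 0)"
| "int_rep_entry \<gamma> (RowPar e m) (RowPar f m') =
     (if e = act \<gamma> ` f \<and> m = m' then edge_sign \<gamma> e else 0)"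
| "int_rep_entry \<gamma> (RowH k) (RowH l) = (if k = act \<gamma> l then 1 else 0)"
| "int_rep_entry \<gamma> _ _ = 0"

text \<open>The external representation, entrywise with respect to the column labels.\<close>

definition hyp_block :: "nat \<Rightarrow> (nat \<Rightarrow> real vec) \<Rightarrow> bit list \<Rightarrow> 'v evert \<Rightarrow> real mat" where
  "hyp_block d \<tau> \<gamma> i =
     four_block_mat (1\<^sub>m d) (0\<^sub>m d 1) (mat_of_rows d [- shift d \<tau> \<gamma> i]) (1\<^sub>m 1)"

fun ext_rep_entry ::
  "nat \<Rightarrow> (nat \<Rightarrow> real vec) \<Rightarrow> bit list \<Rightarrow> 'v evert col_label \<Rightarrow> 'v evert col_label \<Rightarrow> real" where
  "ext_rep_entry d \<tau> \<gamma> (ColP i c) (ColP j c') = (if i = act \<gamma> j \<and> c = c' then 1 else 0)"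
| "ext_rep_entry d \<tau> \<gamma> (ColH i c) (ColH j c') =
     (if i = act \<gamma> j then hyp_block d \<tau> \<gamma> i $$ (c, c') else 0)"
| "ext_rep_entry d \<tau> \<gamma> _ _ = 0"

definition irrep :: "nat \<Rightarrow> bit list \<Rightarrow> bit list \<Rightarrow> real" where
  "irrep t \<gamma> \<gamma>' = (-1) ^ (\<Sum>h<t. of_bool (\<gamma>' ! h * \<gamma> ! h = 1))"

text \<open>The vectors on which every $\gamma\in\Gamma$ acts, through \<open>P\<close>, as multiplication by
  \<open>\<rho> \<gamma>\<close>.\<close>

definition isotypic ::
  "nat \<Rightarrow> nat \<Rightarrow> (bit list \<Rightarrow> real mat) \<Rightarrow> (bit list \<Rightarrow> real) \<Rightarrow> real vec set" where
  "isotypic t n P \<rho> = {x \<in> carrier_vec n. \<forall>\<gamma>\<in>bits t. P \<gamma> *\<^sub>v x = \<rho> \<gamma> \<cdot>\<^sub>v x}"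

end

theory Submission
  imports Defs "Jordan_Normal_Form.DL_Rank"
begin

text \<open>The rigidity matrix $R$ intertwines the two representations: $P'_E(\gamma) R = R P'_V(\gamma)$.
  A row of $R$ is carried by \<open>\<gamma>\<close> to the row of the image edge, with a sign change exactly when the
  edge is extruded in a direction \<open>h\<close> with $\gamma_h = 1$, because \<open>\<gamma>\<close> then interchanges the roles of its
  ends. The only rows with a nonzero entry in a $\dot r$-column are those of the
  point-hyperplane edges; there the shear in $P'_V$ compensates the translation of the point, provided
  that point and hyperplane are shifted by the same vector, and this is where the hypothesis on
  extrusion directions enters. Since $P'_E(\gamma)$ is symmetric, $y^T R x = 0$ whenever \<open>y\<close> and \<open>x\<close>
  belong to different irreducible representations, so bases of the isotypic subspaces
  block-diagonalize $R$.\<close>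

section \<open>Characters of the extrusion group\<close>

text \<open>The block form uses \<open>B\<^sup>T\<close> and not the inverse of \<open>B\<close>, so
  the rows need more than a representation: P'_E must be symmetric. It is, because every \<gamma> is
  an involution and edge signs are constant on orbits. The columns offer nothing comparable, since
  the shears in P'_V are in general not orthogonal maps. Isotypic subspaces are therefore split off
  by averaging over the group, which uses only the homomorphism law; the averages are real because
  all characters of Z_2^t take the values 1 and -1. The homomorphism law itself is a cocycle
  identity of the translation vectors for P'_V, and multiplicativity of the edge signs for P'_E. The
  obstacle is the star. Contraction at h deletes \<tau>_h from the translation of a hyperplane
  vertex, while a point never lies over F_h and keeps it, so adjacent vertices may be translated
  differently. Rows between hyperplanes do not notice, as they contain only normals, which are
  invariant; rows between a point and a hyperplane do.\<close>

definition add_bits :: "bit list \<Rightarrow> bit list \<Rightarrow> bit list" where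
  "add_bits = map2 (+)"

lemma length_add_bits [simp]: "length (add_bits \<gamma> \<delta>) = min (length \<gamma>) (length \<delta>)"
  by (simp add: add_bits_def)

lemma nth_add_bits [simp]:
  "h < length \<gamma> \<Longrightarrow> h < length \<delta> \<Longrightarrow> add_bits \<gamma> \<delta> ! h = \<gamma> ! h + \<delta> ! h"
  by (simp add: add_bits_def)

lemma bit_add_add_cancel [simp]: "b + (b + c) = (c :: bit)"
  by (cases b; cases c) simp_all

lemma add_bits_in_bits [simp]:
  "\<gamma> \<in> bits t \<Longrightarrow> \<delta> \<in> bits t \<Longrightarrow> add_bits \<gamma> \<delta> \<in> bits t"
  by (simp add: bits_def)

lemma add_bits_self: "add_bits \<gamma> \<gamma> = replicate (length \<gamma>) (0 :: bit)"
  by (rule nth_equalityI) auto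

lemma add_bits_cancel:
  "length \<gamma> = length \<delta> \<Longrightarrow> add_bits \<gamma> (add_bits \<gamma> \<delta>) = (\<delta> :: bit list)"
  by (rule nth_equalityI) (simp_all del: add_bit_eq_xor)

lemma finite_bits: "finite (bits t)"
proof -
  have "finite (UNIV :: bit set)"
    by (rule finite_subset [of _ "{0, 1}"]) (use bit.exhaust in auto)
  then show ?thesis
    unfolding bits_def using finite_lists_length_eq [of UNIV t] by simp
qed

lemma card_bits: "card (bits t) = 2 ^ t"
proof -
  have U: "(UNIV :: bit set) = {0, 1}"
    using bit.exhaust by auto
  have "card (bits t) = card (UNIV :: bit set) ^ t"
    unfolding bits_def using card_lists_length_eq [of "UNIV :: bit set" t] U
    by (metis (mono_tags, lifting) Collect_cong finite.emptyI finite_insert top_greatest)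
  then show ?thesis
    by (simp add: U numeral_2_eq_2)
qed

lemma bij_betw_add_bits:
  assumes "\<delta> \<in> bits t"
  shows "bij_betw (add_bits \<delta>) (bits t) (bits t)"
  by (rule bij_betw_byWitness [where f' = "add_bits \<delta>"])
    (use assms in \<open>auto simp: bits_def add_bits_cancel\<close>)

lemma irrep_pm_one: "irrep t \<gamma> \<gamma>' = 1 \<or> irrep t \<gamma> \<gamma>' = -1"
  unfolding irrep_def by (cases "even (\<Sum>h<t. of_bool (\<gamma>' ! h * \<gamma> ! h = 1) :: nat)") auto

text \<open>One factor per coordinate: multiplicativity, symmetry in the two arguments and the value
  at a unit vector can then be checked factor by factor.\<close>

lemma irrep_prod: "irrep t \<gamma> \<gamma>' = (\<Prod>h<t. if \<gamma>' ! h = 1 \<and> \<gamma> ! h = 1 then -1 else 1)"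
proof -
  have "(-1) ^ of_bool (x * y = 1) = (if x = 1 \<and> y = 1 then -1 else 1 :: real)" for x y :: bit
    by (cases x; cases y) auto
  then show ?thesis
    unfolding irrep_def power_sum by simp
qed

lemma irrep_add:
  assumes "\<gamma>' \<in> bits t" "\<delta> \<in> bits t"
  shows "irrep t \<gamma> (add_bits \<gamma>' \<delta>) = irrep t \<gamma> \<gamma>' * irrep t \<gamma> \<delta>"
  unfolding irrep_prod prod.distrib [symmetric]
proof (rule prod.cong)
  fix h assume "h \<in> {..<t}"
  then have "add_bits \<gamma>' \<delta> ! h = \<gamma>' ! h + \<delta> ! h"
    using assms by (simp add: bits_def)
  then show "(if add_bits \<gamma>' \<delta> ! h = 1 \<and> \<gamma> ! h = 1 then - 1 else 1) =
      (if \<gamma>' ! h = 1 \<and> \<gamma> ! h = 1 then - 1 else 1) * (if \<delta> ! h = 1 \<and> \<gamma> ! h = 1 then - 1 else (1::real))"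
    by (cases "\<gamma>' ! h"; cases "\<delta> ! h") auto
qed simp

lemma irrep_commute: "irrep t \<gamma> \<gamma>' = irrep t \<gamma>' \<gamma>"
  unfolding irrep_prod by (intro prod.cong) auto

lemma irrep_zero [simp]: "irrep t \<gamma> (replicate t 0) = 1"
  unfolding irrep_prod by (intro prod.neutral) auto

lemma irrep_unit:
  assumes "h < t"
  shows "irrep t \<gamma> ((replicate t 0)[h := 1]) = (if \<gamma> ! h = 1 then -1 else 1)"
proof -
  have "irrep t \<gamma> ((replicate t 0)[h := 1]) =
      (\<Prod>g<t. if g = h then (if \<gamma> ! h = 1 then -1 else 1) else 1)"
    unfolding irrep_prod by (rule prod.cong) (auto simp: nth_list_update)
  then show ?thesis
    using assms by (simp add: prod.delta)
qed

text \<open>A coordinate h in which the two elements differ is detected by the unit vector at h: one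
  character is -1 there and the other is 1.\<close>

lemma irrep_separates:
  assumes "\<gamma> \<in> bits t" "\<delta> \<in> bits t" "\<gamma> \<noteq> \<delta>"
  shows "\<exists>\<epsilon>\<in>bits t. irrep t \<gamma> \<epsilon> \<noteq> irrep t \<delta> \<epsilon>"
proof -
  obtain h where h: "h < t" "\<gamma> ! h \<noteq> \<delta> ! h"
    using assms nth_equalityI [of \<gamma> \<delta>] unfolding bits_def by auto
  have "(replicate t 0)[h := 1] \<in> bits t"
    by (simp add: bits_def)
  moreover have "(\<gamma> ! h = 1) \<noteq> (\<delta> ! h = 1)"
    using h by (metis bit_not_one_iff)
  then have "irrep t \<gamma> ((replicate t 0)[h := 1]) \<noteq> irrep t \<delta> ((replicate t 0)[h := 1])"
    using irrep_unit [OF h(1)] by auto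
  ultimately show ?thesis by blast
qed

lemma inj_on_irrep: "inj_on (irrep t) (bits t)"
  using irrep_separates by (metis inj_onI)

text \<open>Character orthogonality with the group element fixed and the character varying. If the
  element is nonzero, some character \<epsilon> is -1 on it, and translating the summation index by
  \<epsilon> turns the sum into its own negative.\<close>

lemma sum_irrep:
  assumes "\<gamma> \<in> bits t"
  shows "(\<Sum>\<delta>\<in>bits t. irrep t \<delta> \<gamma>) = (if \<gamma> = replicate t 0 then 2 ^ t else 0)"
proof (cases "\<gamma> = replicate t 0")
  case True
  then show ?thesis by (simp add: card_bits)
next
  case False
  have "replicate t 0 \<in> bits t"
    by (simp add: bits_def)
  \<comment> \<open>By symmetry of the pairing, an element on which the character of \<gamma> is
    nontrivial is also the index of a character that is nontrivial at \<gamma>.\<close>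
  then obtain \<epsilon> where e: "\<epsilon> \<in> bits t" "irrep t \<gamma> \<epsilon> \<noteq> irrep t (replicate t 0) \<epsilon>"
    using irrep_separates [OF assms _ False] by blast
  then have e1: "irrep t \<epsilon> \<gamma> = -1"
    using irrep_pm_one [of t \<gamma> \<epsilon>] by (simp add: irrep_commute [of t _ \<epsilon>])
  have "(\<Sum>\<delta>\<in>bits t. irrep t \<delta> \<gamma>) = (\<Sum>\<delta>\<in>bits t. irrep t (add_bits \<epsilon> \<delta>) \<gamma>)"
    by (rule sum.reindex_bij_betw [OF bij_betw_add_bits [OF e(1)], symmetric])
  also have "\<dots> = - (\<Sum>\<delta>\<in>bits t. irrep t \<delta> \<gamma>)"
    using irrep_add [OF e(1), of _ \<gamma>] e1
    by (simp add: irrep_commute [of t _ \<gamma>] sum_negf [symmetric])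
  finally show ?thesis
    using False by simp
qed


section \<open>Bases adapted to a representation\<close>

text \<open>Completeness of the projections is a statement about coordinates; this brings such a
  coordinatewise sum back into the span.\<close>

lemma (in vec_space) sum_in_span:
  assumes "S \<subseteq> carrier_vec n" "\<And>k. k < (N :: nat) \<Longrightarrow> f k \<in> span S"
  shows "vec n (\<lambda>j. \<Sum>k<N. f k $ j) \<in> span S"
  using assms(2)
proof (induction N)
  case 0
  have "vec n (\<lambda>j. \<Sum>k<0. f k $ j) = 0\<^sub>v n"
    by (intro eq_vecI) simp_all
  moreover have "0\<^sub>v n \<in> span S"
    unfolding span_def lincomb_def by force
  ultimately show ?case
    by simp
next
  case (Suc N)
  have "span S \<subseteq> carrier_vec n"
    using span_is_subset2 [of S] assms(1) by simp
  then have "f N \<in> carrier_vec n"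
    using Suc.prems [of N] by blast
  then have "vec n (\<lambda>j. \<Sum>k<Suc N. f k $ j) = vec n (\<lambda>j. \<Sum>k<N. f k $ j) + f N"
    by (intro eq_vecI) simp_all
  then show ?case
    using span_add1 [of S "vec n (\<lambda>j. \<Sum>k<N. f k $ j)" "f N"] Suc assms(1) by simp
qed

lemma (in vec_space) mult_mat_vec_lincomb_index:
  assumes "A \<in> carrier_mat m n" "X \<subseteq> carrier_vec n" "finite X" "i < m"
  shows "(A *\<^sub>v lincomb c X) $ i = (\<Sum>x\<in>X. c x * (A *\<^sub>v x) $ i)"
proof -
  have "(A *\<^sub>v lincomb c X) $ i = (\<Sum>j = 0..<n. A $$ (i, j) * (\<Sum>x\<in>X. c x * x $ j))"
    using assms by (simp add: scalar_prod_def lincomb_dim lincomb_index)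
  also have "\<dots> = (\<Sum>j = 0..<n. \<Sum>x\<in>X. c x * (A $$ (i, j) * x $ j))"
    by (simp add: sum_distrib_left mult.left_commute)
  also have "\<dots> = (\<Sum>x\<in>X. \<Sum>j = 0..<n. c x * (A $$ (i, j) * x $ j))"
    by (rule sum.swap)
  also have "\<dots> = (\<Sum>x\<in>X. c x * (A *\<^sub>v x) $ i)"
  proof (rule sum.cong)
    fix x assume "x \<in> X"
    then have "dim_vec x = n"
      using assms(2) by auto
    then show "(\<Sum>j = 0..<n. c x * (A $$ (i, j) * x $ j)) = c x * (A *\<^sub>v x) $ i"
      using assms by (simp add: scalar_prod_def sum_distrib_left)
  qed simp
  finally show ?thesis .
qed

text \<open>The spaces \<open>W \<kappa>\<close> are the images of a complete family of orthogonal idempotents \<open>\<pi> \<kappa>\<close>.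
  A minimal generating subset of the set of all \<open>\<pi> \<kappa> e\<^sub>i\<close> consists of vectors lying in some
  \<open>W \<kappa>\<close>, and sorting these vectors gives bases of all the \<open>W \<kappa>\<close> at once.\<close>

lemma ex_basis_adapted_to_projections:
  fixes \<pi> :: "nat \<Rightarrow> real mat" and W :: "nat \<Rightarrow> real vec set"
  assumes carr: "\<And>\<kappa>. \<kappa> < N \<Longrightarrow> \<pi> \<kappa> \<in> carrier_mat n n" "\<And>\<kappa>. \<kappa> < N \<Longrightarrow> W \<kappa> \<subseteq> carrier_vec n"
    and into: "\<And>\<kappa> v. \<kappa> < N \<Longrightarrow> v \<in> carrier_vec n \<Longrightarrow> \<pi> \<kappa> *\<^sub>v v \<in> W \<kappa>"
    and fixed: "\<And>\<kappa> w. \<kappa> < N \<Longrightarrow> w \<in> W \<kappa> \<Longrightarrow> \<pi> \<kappa> *\<^sub>v w = w"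
    and zero: "\<And>\<kappa> \<mu> w. \<kappa> < N \<Longrightarrow> \<mu> < N \<Longrightarrow> \<kappa> \<noteq> \<mu> \<Longrightarrow> w \<in> W \<kappa> \<Longrightarrow> \<pi> \<mu> *\<^sub>v w = 0\<^sub>v n"
    and complete: "\<And>v i. v \<in> carrier_vec n \<Longrightarrow> i < n \<Longrightarrow> (\<Sum>\<kappa><N. (\<pi> \<kappa> *\<^sub>v v) $ i) = v $ i"
  shows "\<exists>b. (\<forall>\<kappa><N. basis_of n (W \<kappa>) (b \<kappa>)) \<and>
    basis_of n (carrier_vec n) (concat (map b [0..<N]))"
proof -
  interpret vec_space "TYPE(real)" n .
  define S where "S = (\<lambda>(\<kappa>, i). \<pi> \<kappa> *\<^sub>v unit_vec n i) ` ({..<N} \<times> {..<n})"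
  have S_W: "\<exists>\<kappa><N. v \<in> W \<kappa>" if v: "v \<in> S" for v
  proof -
    obtain \<kappa> i where "\<kappa> < N" "i < n" "v = \<pi> \<kappa> *\<^sub>v unit_vec n i"
      using v unfolding S_def by auto
    then show ?thesis
      using into by auto
  qed
  have S_carr: "S \<subseteq> carrier_vec n"
    using S_W carr(2) by blast
  have finS: "finite S"
    unfolding S_def by simp
  have unit_span: "unit_vec n i \<in> span S" if i: "i < n" for i
  proof -
    have "\<pi> \<kappa> *\<^sub>v unit_vec n i \<in> span S" if "\<kappa> < N" for \<kappa>
    proof -
      have "\<pi> \<kappa> *\<^sub>v unit_vec n i \<in> S"
        unfolding S_def using i that by (intro image_eqI [of _ _ "(\<kappa>, i)"]) auto
      then show ?thesis
        using in_own_span [of S] S_carr by auto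
    qed
    then have "vec n (\<lambda>j. \<Sum>\<kappa><N. (\<pi> \<kappa> *\<^sub>v unit_vec n i) $ j) \<in> span S"
      by (rule sum_in_span [OF S_carr])
    \<comment> \<open>Completeness, applied to a unit vector, recovers it from its own projections,
      so \<open>S\<close> generates the whole space.\<close>
    moreover have "vec n (\<lambda>j. \<Sum>\<kappa><N. (\<pi> \<kappa> *\<^sub>v unit_vec n i) $ j) = unit_vec n i"
      using complete [OF unit_vec_carrier, of _ i] by (intro eq_vecI) simp_all
    ultimately show ?thesis
      by simp
  qed
  have gen: "span S = carrier_vec n"
  proof
    show "span S \<subseteq> carrier_vec n"
      using S_carr by (simp add: span_is_subset2)
    have "set (unit_vecs n) \<subseteq> span S"
      using unit_span by (auto simp: unit_vecs_def)
    then show "carrier_vec n \<subseteq> span S"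
      unfolding span_unit_vecs_is_carrier [symmetric]
      using span_is_subset span_is_submodule S_carr by simp
  qed
  obtain T where T: "T \<subseteq> S" "minimal T (\<lambda>A. A \<subseteq> carrier_vec n \<and> span A = carrier_vec n)"
    using minimal_exists [of S "\<lambda>A. A \<subseteq> carrier_vec n \<and> span A = carrier_vec n"] finS S_carr gen by auto
  have T_basis: "basis T"
    using min_gen_is_basis T(2) by blast
  then have li: "lin_indpt T" and spT: "span T = carrier_vec n" and T_carr: "T \<subseteq> carrier_vec n"
    by (auto simp: basis_def)
  have finT: "finite T"
    using T(1) finS finite_subset by blast
  define b where "b = (\<lambda>\<kappa>. SOME bs. distinct bs \<and> set bs = T \<inter> W \<kappa>)"
  have b: "distinct (b \<kappa>)" "set (b \<kappa>) = T \<inter> W \<kappa>" for \<kappa>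
    unfolding b_def atomize_conj
    by (rule someI_ex) (use finT finite_distinct_list [of "T \<inter> W \<kappa>"] in auto)
  \<comment> \<open>Zero is the only vector that two of the spaces can share, so disjointness of the
    parts of \<open>T\<close> rests on its absence from \<open>T\<close>.\<close>
  have zero_notin: "0\<^sub>v n \<notin> T"
  proof -
    have "(1 :: real) \<notin> {0}"
      by simp
    then have "(UNIV :: real set) \<noteq> {0}"
      by blast
    then show ?thesis
      using li T_carr zero_nin_lin_indpt [of T] by simp
  qed
  have disj: "T \<inter> W \<kappa> \<inter> W \<mu> = {}" if "\<kappa> < N" "\<mu> < N" "\<kappa> \<noteq> \<mu>" for \<kappa> \<mu>
  proof -
    have "w = 0\<^sub>v n" if "w \<in> W \<kappa>" "w \<in> W \<mu>" for w
      using zero [of \<kappa> \<mu> w] fixed [of \<mu> w] that \<open>\<kappa> < N\<close> \<open>\<mu> < N\<close> \<open>\<kappa> \<noteq> \<mu>\<close> by simp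
    then show ?thesis
      using zero_notin by blast
  qed
  have basis_W: "basis_of n (W \<kappa>) (b \<kappa>)" if \<kappa>: "\<kappa> < N" for \<kappa>
  proof -
    have sub: "T \<inter> W \<kappa> \<subseteq> carrier_vec n"
      using T_carr by blast
    note lin = mult_mat_vec_lincomb_index [OF carr(1) [OF \<kappa>]]
    have "span (T \<inter> W \<kappa>) = W \<kappa>"
    proof
      show "span (T \<inter> W \<kappa>) \<subseteq> W \<kappa>"
      proof
        fix v assume "v \<in> span (T \<inter> W \<kappa>)"
        then obtain c where v: "v = lincomb c (T \<inter> W \<kappa>)"
          using finite_in_span [of "T \<inter> W \<kappa>" v] finT sub by auto
        have vc: "v \<in> carrier_vec n"
          unfolding v using sub by simp
        \<comment> \<open>\<open>W \<kappa>\<close> is not given as a subspace. A combination of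
          vectors fixed by \<open>\<pi> \<kappa>\<close> is again fixed, and as a value of
          \<open>\<pi> \<kappa>\<close> it lies in \<open>W \<kappa>\<close>.\<close>
        have "\<pi> \<kappa> *\<^sub>v v = v"
        proof (rule eq_vecI)
          fix i assume "i < dim_vec v"
          then have i: "i < n" using vc by simp
          show "(\<pi> \<kappa> *\<^sub>v v) $ i = v $ i"
            unfolding v lin [OF sub _ i, OF finite_Int, OF disjI1, OF finT] lincomb_index [OF i sub]
            by (rule sum.cong) (use fixed \<kappa> in auto)
        qed (use carr(1) [OF \<kappa>] vc in auto)
        then show "v \<in> W \<kappa>"
          using into [OF \<kappa> vc] by simp
      qed
      show "W \<kappa> \<subseteq> span (T \<inter> W \<kappa>)"
      proof
        fix v assume v: "v \<in> W \<kappa>"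
        then have vc: "v \<in> carrier_vec n"
          using carr(2) \<kappa> by blast
        then obtain c where c: "v = lincomb c T"
          using finite_in_span [of T v] finT T_carr spT by auto
        \<comment> \<open>Apply \<open>\<pi> \<kappa>\<close> to the expansion of v in
          \<open>T\<close>: the members of \<open>T\<close> outside \<open>W \<kappa>\<close> lie in
          another \<open>W \<mu>\<close> and are annihilated, the others are fixed. So the same
          coefficients work on the smaller set.\<close>
        have "v = lincomb c (T \<inter> W \<kappa>)"
        proof (rule eq_vecI)
          fix i assume "i < dim_vec (lincomb c (T \<inter> W \<kappa>))"
          then have i: "i < n"
            using sub finT by (simp add: lincomb_dim)
          have "v $ i = (\<pi> \<kappa> *\<^sub>v v) $ i"
            using fixed [OF \<kappa> v] by simp
          also have "\<dots> = (\<Sum>x\<in>T. c x * (\<pi> \<kappa> *\<^sub>v x) $ i)"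
            unfolding c by (rule lin [OF T_carr finT i])
          also have "\<dots> = (\<Sum>x\<in>T \<inter> W \<kappa>. c x * (\<pi> \<kappa> *\<^sub>v x) $ i)"
          proof (rule sum.mono_neutral_right)
            show "\<forall>x\<in>T - T \<inter> W \<kappa>. c x * (\<pi> \<kappa> *\<^sub>v x) $ i = 0"
            proof
              fix x assume x: "x \<in> T - T \<inter> W \<kappa>"
              then obtain \<mu> where "\<mu> < N" "x \<in> W \<mu>"
                using S_W T(1) by blast
              moreover from this x have "\<mu> \<noteq> \<kappa>"
                by blast
              ultimately show "c x * (\<pi> \<kappa> *\<^sub>v x) $ i = 0"
                using zero [of \<mu> \<kappa> x] \<kappa> i x by auto
            qed
          qed (use finT in auto)
          also have "\<dots> = (\<Sum>x\<in>T \<inter> W \<kappa>. c x * x $ i)"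
            by (rule sum.cong) (use fixed \<kappa> in auto)
          finally show "v $ i = lincomb c (T \<inter> W \<kappa>) $ i"
            by (simp add: lincomb_index [OF i sub])
        qed (use vc sub finT in \<open>simp add: lincomb_dim\<close>)
        then show "v \<in> span (T \<inter> W \<kappa>)"
          using finT sub unfolding span_def by blast
      qed
    qed
    moreover have "lin_indpt (T \<inter> W \<kappa>)"
      using li subset_li_is_li [of T "T \<inter> W \<kappa>"] by blast
    ultimately show ?thesis
      unfolding basis_of_def using b T_carr by auto
  qed
  have set_concat: "set (concat (map b [0..<N])) = T"
    using T(1) S_W b(2) by fastforce
  \<comment> \<open>The induction runs over prefixes below N, because disjointness of the parts is
    known only for indices below N.\<close>
  have "distinct (concat (map b [0..<M]))" if "M \<le> N" for M
    using that
  proof (induction M)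
    case (Suc M)
    have "set (b \<kappa>) \<inter> set (b M) = {}" if "\<kappa> < M" for \<kappa>
      using disj [of \<kappa> M] that Suc.prems unfolding b(2) by auto
    then have "set (concat (map b [0..<M])) \<inter> set (b M) = {}"
      by fastforce
    then show ?case
      using Suc.IH Suc.prems b(1) [of M] by simp
  qed simp
  then have "basis_of n (carrier_vec n) (concat (map b [0..<N]))"
    unfolding basis_of_def set_concat using li spT T_carr by auto
  then show ?thesis
    using basis_W by blast
qed


text \<open>A basis of the whole space has n members, so the matrix is square; independence of its
  columns is full rank, hence a nonzero determinant.\<close>

lemma basis_of_carrier_vec_invertible:
  assumes "basis_of n (carrier_vec n) bs"
  shows "mat_of_cols n bs \<in> carrier_mat n n" "invertible_mat (mat_of_cols n bs)"
    "cols (mat_of_cols n bs) = bs"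
proof -
  interpret vec_space "TYPE(real)" n .
  have bs: "distinct bs" "set bs \<subseteq> carrier_vec n" "lin_indpt (set bs)" "span (set bs) = carrier_vec n"
    using assms by (auto simp: basis_of_def)
  then have "basis (set bs)"
    by (auto simp: basis_def)
  then have "length bs = n"
    using dim_basis [of "set bs"] dim_is_n bs(1) distinct_card by force
  then show carr: "mat_of_cols n bs \<in> carrier_mat n n"
    by (simp add: mat_of_cols_def)
  show cols: "cols (mat_of_cols n bs) = bs"
    using bs(2) by simp
  have "rank (mat_of_cols n bs) = n"
    using lin_indpt_full_rank [OF carr] cols bs by simp
  then have "det (mat_of_cols n bs) \<noteq> 0"
    using det_rank_iff [OF carr] by simp
  then have "mat_of_cols n bs \<in> Units (ring_mat TYPE(real) n ())"
    by (rule det_non_zero_imp_unit [OF carr])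
  then obtain B where "B \<in> carrier_mat n n" "B * mat_of_cols n bs = 1\<^sub>m n"
    "mat_of_cols n bs * B = 1\<^sub>m n"
    by (auto simp: Units_def ring_mat_def)
  then show "invertible_mat (mat_of_cols n bs)"
    using carr unfolding invertible_mat_def inverts_mat_def square_mat.simps
    by (metis carrier_matD)
qed

section \<open>Projections onto the isotypic subspaces\<close>

definition bits_rep :: "nat \<Rightarrow> nat \<Rightarrow> (bit list \<Rightarrow> real mat) \<Rightarrow> bool" where
  "bits_rep t n P \<longleftrightarrow> (\<forall>\<gamma>\<in>bits t. P \<gamma> \<in> carrier_mat n n) \<and> P (replicate t 0) = 1\<^sub>m n \<and>
     (\<forall>\<gamma>\<in>bits t. \<forall>\<delta>\<in>bits t. P (add_bits \<gamma> \<delta>) = P \<gamma> * P \<delta>)"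

text \<open>The usual averaging formula with \<rho>(\<gamma>) in place of the character at the
  inverse element: every \<gamma> is its own inverse, and the characters are real.\<close>

definition irrep_projection ::
  "nat \<Rightarrow> nat \<Rightarrow> (bit list \<Rightarrow> real mat) \<Rightarrow> (bit list \<Rightarrow> real) \<Rightarrow> real mat" where
  "irrep_projection t n P \<rho> =
     mat n n (\<lambda>(i, j). (\<Sum>\<gamma>\<in>bits t. \<rho> \<gamma> * P \<gamma> $$ (i, j)) / 2 ^ t)"

lemma irrep_projection_carrier [simp]: "irrep_projection t n P \<rho> \<in> carrier_mat n n"
  by (simp add: irrep_projection_def)

lemma irrep_projection_mult_vec:
  assumes "bits_rep t n P" "v \<in> carrier_vec n" "i < n"
  shows "(irrep_projection t n P \<rho> *\<^sub>v v) $ i = (\<Sum>\<gamma>\<in>bits t. \<rho> \<gamma> * (P \<gamma> *\<^sub>v v) $ i) / 2 ^ t"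
proof -
  have P: "(P \<gamma> *\<^sub>v v) $ i = (\<Sum>j = 0..<n. P \<gamma> $$ (i, j) * v $ j)" if "\<gamma> \<in> bits t" for \<gamma>
    using assms that unfolding bits_rep_def by (auto simp: scalar_prod_def)
  have "(irrep_projection t n P \<rho> *\<^sub>v v) $ i =
      (\<Sum>j = 0..<n. (\<Sum>\<gamma>\<in>bits t. \<rho> \<gamma> * P \<gamma> $$ (i, j)) / 2 ^ t * v $ j)"
    using assms by (simp add: irrep_projection_def scalar_prod_def)
  also have "\<dots> = (\<Sum>j = 0..<n. \<Sum>\<gamma>\<in>bits t. \<rho> \<gamma> * (P \<gamma> $$ (i, j) * v $ j)) / 2 ^ t"
    by (simp add: sum_divide_distrib sum_distrib_right mult.assoc)
  also have "\<dots> = (\<Sum>\<gamma>\<in>bits t. \<Sum>j = 0..<n. \<rho> \<gamma> * (P \<gamma> $$ (i, j) * v $ j)) / 2 ^ t"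
    by (subst sum.swap) simp
  also have "\<dots> = (\<Sum>\<gamma>\<in>bits t. \<rho> \<gamma> * (P \<gamma> *\<^sub>v v) $ i) / 2 ^ t"
    using P by (simp add: sum_distrib_left)
  finally show ?thesis .
qed

text \<open>Applying P(\<delta>) translates the summation index by \<delta>. The weight adapts by
  \<rho>(\<gamma>) = \<rho>(\<delta>) \<rho>(\<delta> + \<gamma>), valid because \<rho>(\<delta>)
  squares to 1, and the factor \<rho>(\<delta>) comes out of the sum.\<close>

lemma irrep_projection_in_isotypic:
  assumes P: "bits_rep t n P" and v: "v \<in> carrier_vec n"
  shows "irrep_projection t n P (irrep t \<kappa>) *\<^sub>v v \<in> isotypic t n P (irrep t \<kappa>)"
proof -
  define w where "w = irrep_projection t n P (irrep t \<kappa>) *\<^sub>v v"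
  have w: "w \<in> carrier_vec n"
    unfolding w_def using v by (intro mult_mat_vec_carrier) auto
  have "P \<delta> *\<^sub>v w = irrep t \<kappa> \<delta> \<cdot>\<^sub>v w" if \<delta>: "\<delta> \<in> bits t" for \<delta>
  proof (rule eq_vecI)
    have Pc: "P \<gamma> \<in> carrier_mat n n" if "\<gamma> \<in> bits t" for \<gamma>
      using P that by (auto simp: bits_rep_def)
    show "dim_vec (P \<delta> *\<^sub>v w) = dim_vec (irrep t \<kappa> \<delta> \<cdot>\<^sub>v w)"
      using Pc [OF \<delta>] w by simp
    fix i assume "i < dim_vec (irrep t \<kappa> \<delta> \<cdot>\<^sub>v w)"
    then have i: "i < n"
      using w by simp
    have comp: "(P (add_bits \<delta> \<gamma>) *\<^sub>v v) $ i = (\<Sum>j = 0..<n. P \<delta> $$ (i, j) * (P \<gamma> *\<^sub>v v) $ j)"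
      if \<gamma>: "\<gamma> \<in> bits t" for \<gamma>
    proof -
      have "P (add_bits \<delta> \<gamma>) *\<^sub>v v = P \<delta> *\<^sub>v (P \<gamma> *\<^sub>v v)"
        using P \<gamma> \<delta> assoc_mult_mat_vec [OF Pc [OF \<delta>] Pc [OF \<gamma>] v] by (simp add: bits_rep_def)
      then show ?thesis
        using Pc [OF \<gamma>] Pc [OF \<delta>] i by (simp add: scalar_prod_def)
    qed
    have "(P \<delta> *\<^sub>v w) $ i = (\<Sum>j = 0..<n. P \<delta> $$ (i, j) * w $ j)"
      using Pc [OF \<delta>] i w by (simp add: scalar_prod_def)
    also have "\<dots> = (\<Sum>j = 0..<n. P \<delta> $$ (i, j) * ((\<Sum>\<gamma>\<in>bits t. irrep t \<kappa> \<gamma> * (P \<gamma> *\<^sub>v v) $ j) / 2 ^ t))"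
      unfolding w_def using irrep_projection_mult_vec [OF P v] by simp
    also have "\<dots> = (\<Sum>j = 0..<n. \<Sum>\<gamma>\<in>bits t. irrep t \<kappa> \<gamma> * (P \<delta> $$ (i, j) * (P \<gamma> *\<^sub>v v) $ j)) / 2 ^ t"
      by (simp add: sum_divide_distrib sum_distrib_left mult.left_commute)
    also have "\<dots> = (\<Sum>\<gamma>\<in>bits t. irrep t \<kappa> \<gamma> * (P (add_bits \<delta> \<gamma>) *\<^sub>v v) $ i) / 2 ^ t"
      by (subst sum.swap) (simp add: comp sum_distrib_left)
    also have "(\<Sum>\<gamma>\<in>bits t. irrep t \<kappa> \<gamma> * (P (add_bits \<delta> \<gamma>) *\<^sub>v v) $ i) =
        (\<Sum>\<gamma>\<in>bits t. irrep t \<kappa> \<delta> * (irrep t \<kappa> (add_bits \<delta> \<gamma>) * (P (add_bits \<delta> \<gamma>) *\<^sub>v v) $ i))"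
    proof (rule sum.cong)
      fix \<gamma> assume "\<gamma> \<in> bits t"
      then have "irrep t \<kappa> \<gamma> = irrep t \<kappa> \<delta> * irrep t \<kappa> (add_bits \<delta> \<gamma>)"
        using irrep_add [OF \<delta>, of \<gamma> \<kappa>] irrep_pm_one [of t \<kappa> \<delta>] by auto
      then show "irrep t \<kappa> \<gamma> * (P (add_bits \<delta> \<gamma>) *\<^sub>v v) $ i =
          irrep t \<kappa> \<delta> * (irrep t \<kappa> (add_bits \<delta> \<gamma>) * (P (add_bits \<delta> \<gamma>) *\<^sub>v v) $ i)"
        by simp
    qed simp
    also have "\<dots> = (\<Sum>\<gamma>\<in>bits t. irrep t \<kappa> \<delta> * (irrep t \<kappa> \<gamma> * (P \<gamma> *\<^sub>v v) $ i))"
      by (rule sum.reindex_bij_betw [OF bij_betw_add_bits [OF \<delta>]])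
    also have "\<dots> / 2 ^ t = irrep t \<kappa> \<delta> * w $ i"
      using irrep_projection_mult_vec [OF P v i] by (simp add: w_def sum_distrib_left)
    also have "\<dots> = (irrep t \<kappa> \<delta> \<cdot>\<^sub>v w) $ i"
      using i w by simp
    finally show "(P \<delta> *\<^sub>v w) $ i = (irrep t \<kappa> \<delta> \<cdot>\<^sub>v w) $ i" .
  qed
  then show ?thesis
    using w by (simp add: isotypic_def w_def)
qed

text \<open>Each of the 2^t averaged terms equals w, since \<rho>(\<gamma>) is applied twice and
  squares to 1.\<close>

lemma irrep_projection_isotypic:
  assumes P: "bits_rep t n P" and w: "w \<in> isotypic t n P (irrep t \<kappa>)"
  shows "irrep_projection t n P (irrep t \<kappa>) *\<^sub>v w = w"
proof (rule eq_vecI)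
  have wc: "w \<in> carrier_vec n"
    using w by (simp add: isotypic_def)
  then show "dim_vec (irrep_projection t n P (irrep t \<kappa>) *\<^sub>v w) = dim_vec w"
    by (simp add: irrep_projection_def)
  fix i assume "i < dim_vec w"
  then have i: "i < n"
    using wc by simp
  have "irrep t \<kappa> \<gamma> * (P \<gamma> *\<^sub>v w) $ i = w $ i" if "\<gamma> \<in> bits t" for \<gamma>
    using w that i wc irrep_pm_one [of t \<kappa> \<gamma>] by (auto simp: isotypic_def)
  then show "(irrep_projection t n P (irrep t \<kappa>) *\<^sub>v w) $ i = w $ i"
    using irrep_projection_mult_vec [OF P wc i] by (simp add: card_bits)
qed

lemma isotypic_disjoint:
  assumes "\<kappa> \<in> bits t" "\<mu> \<in> bits t" "\<kappa> \<noteq> \<mu>"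
    and w: "w \<in> isotypic t n P (irrep t \<kappa>)" "w \<in> isotypic t n P (irrep t \<mu>)"
  shows "w = 0\<^sub>v n"
proof -
  obtain \<gamma> where \<gamma>: "\<gamma> \<in> bits t" "irrep t \<kappa> \<gamma> \<noteq> irrep t \<mu> \<gamma>"
    using irrep_separates assms(1-3) by blast
  have wc: "w \<in> carrier_vec n"
    using w by (simp add: isotypic_def)
  have eq: "irrep t \<kappa> \<gamma> \<cdot>\<^sub>v w = irrep t \<mu> \<gamma> \<cdot>\<^sub>v w"
    using w \<gamma>(1) by (auto simp: isotypic_def)
  have "w $ i = 0" if "i < n" for i
  proof -
    have "(irrep t \<kappa> \<gamma> \<cdot>\<^sub>v w) $ i = (irrep t \<mu> \<gamma> \<cdot>\<^sub>v w) $ i"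
      by (simp add: eq)
    then show ?thesis
      using \<gamma>(2) that wc by simp
  qed
  then show ?thesis
    using wc by (intro eq_vecI) auto
qed

text \<open>The projection of w is a scalar multiple of w and so stays in the space of \<kappa>; as
  a projection it also lies in the space of \<mu>. These meet only in zero, which settles the claim
  without evaluating the scalar.\<close>

lemma irrep_projection_other:
  assumes P: "bits_rep t n P" and "\<kappa> \<in> bits t" "\<mu> \<in> bits t" "\<kappa> \<noteq> \<mu>"
    and w: "w \<in> isotypic t n P (irrep t \<kappa>)"
  shows "irrep_projection t n P (irrep t \<mu>) *\<^sub>v w = 0\<^sub>v n"
proof -
  have wc: "w \<in> carrier_vec n"
    using w by (simp add: isotypic_def)
  have "irrep_projection t n P (irrep t \<mu>) *\<^sub>v w \<in> isotypic t n P (irrep t \<kappa>)"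
  proof -
    have "(irrep_projection t n P (irrep t \<mu>) *\<^sub>v w) =
        ((\<Sum>\<gamma>\<in>bits t. irrep t \<mu> \<gamma> * irrep t \<kappa> \<gamma>) / 2 ^ t) \<cdot>\<^sub>v w"
    proof (rule eq_vecI)
      fix i assume "i < dim_vec (((\<Sum>\<gamma>\<in>bits t. irrep t \<mu> \<gamma> * irrep t \<kappa> \<gamma>) / 2 ^ t) \<cdot>\<^sub>v w)"
      then have i: "i < n"
        using wc by simp
      have "(P \<gamma> *\<^sub>v w) $ i = irrep t \<kappa> \<gamma> * w $ i"
        if "\<gamma> \<in> bits t" for \<gamma>
        using w that i wc by (auto simp: isotypic_def)
      then show "(irrep_projection t n P (irrep t \<mu>) *\<^sub>v w) $ i =
          (((\<Sum>\<gamma>\<in>bits t. irrep t \<mu> \<gamma> * irrep t \<kappa> \<gamma>) / 2 ^ t) \<cdot>\<^sub>v w) $ i"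
        using irrep_projection_mult_vec [OF P wc i] i wc
        by (simp add: sum_distrib_right mult.assoc)
    qed (use wc in \<open>simp add: irrep_projection_def\<close>)
    moreover have "c \<cdot>\<^sub>v w \<in> isotypic t n P (irrep t \<kappa>)" for c
    proof -
      have "P \<gamma> *\<^sub>v (c \<cdot>\<^sub>v w) = irrep t \<kappa> \<gamma> \<cdot>\<^sub>v (c \<cdot>\<^sub>v w)" if "\<gamma> \<in> bits t" for \<gamma>
      proof -
        have "P \<gamma> \<in> carrier_mat n n"
          using P that by (auto simp: bits_rep_def)
        then have "P \<gamma> *\<^sub>v (c \<cdot>\<^sub>v w) = c \<cdot>\<^sub>v (P \<gamma> *\<^sub>v w)"
          using wc by (rule mult_mat_vec)
        then show ?thesis
          using w that by (simp add: isotypic_def smult_smult_assoc mult.commute)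
      qed
      then show ?thesis
        using wc by (simp add: isotypic_def)
    qed
    ultimately show ?thesis
      by simp
  qed
  then show ?thesis
    using isotypic_disjoint [OF assms(2-4)] irrep_projection_in_isotypic [OF P wc] by blast
qed

text \<open>After exchanging the sums, \<open>sum_irrep\<close> leaves only the identity element,
  with weight 2^t.\<close>

lemma sum_irrep_projection:
  assumes P: "bits_rep t n P" and v: "v \<in> carrier_vec n" and i: "i < n"
  shows "(\<Sum>\<kappa>\<in>bits t. (irrep_projection t n P (irrep t \<kappa>) *\<^sub>v v) $ i) = v $ i"
proof -
  have "(\<Sum>\<kappa>\<in>bits t. (irrep_projection t n P (irrep t \<kappa>) *\<^sub>v v) $ i) =
      (\<Sum>\<kappa>\<in>bits t. \<Sum>\<gamma>\<in>bits t. irrep t \<kappa> \<gamma> * (P \<gamma> *\<^sub>v v) $ i) / 2 ^ t"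
    using irrep_projection_mult_vec [OF P v i] by (simp add: sum_divide_distrib)
  also have "\<dots> = (\<Sum>\<gamma>\<in>bits t. (\<Sum>\<kappa>\<in>bits t. irrep t \<kappa> \<gamma>) * (P \<gamma> *\<^sub>v v) $ i) / 2 ^ t"
    by (subst sum.swap) (simp add: sum_distrib_right)
  also have "(\<Sum>\<gamma>\<in>bits t. (\<Sum>\<kappa>\<in>bits t. irrep t \<kappa> \<gamma>) * (P \<gamma> *\<^sub>v v) $ i) =
      (\<Sum>\<gamma>\<in>bits t. if \<gamma> = replicate t 0 then 2 ^ t * (P \<gamma> *\<^sub>v v) $ i else 0)"
    by (rule sum.cong) (simp_all add: sum_irrep)
  also have "\<dots> = 2 ^ t * (P (replicate t 0) *\<^sub>v v) $ i"
    using finite_bits [of t] by (simp add: bits_def)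
  finally show ?thesis
    using P v by (simp add: bits_rep_def)
qed

lemma ex_symmetry_adapted_basis:
  assumes P: "bits_rep t n P" and \<rho>: "bij_betw \<rho> {..<2 ^ t} (irrep t ` bits t)"
  shows "\<exists>b. (\<forall>\<kappa><2 ^ t. basis_of n (isotypic t n P (\<rho> \<kappa>)) (b \<kappa>)) \<and>
    basis_of n (carrier_vec n) (concat (map b [0..<2 ^ t]))"
proof -
  have "\<exists>\<mu>\<in>bits t. \<rho> \<kappa> = irrep t \<mu>" if "\<kappa> < 2 ^ t" for \<kappa>
    using bij_betw_apply [OF \<rho>] that by auto
  \<comment> \<open>The enumeration \<rho> is arbitrary; \<sigma> recovers the group element that
    indexes each character.\<close>
  then obtain \<sigma> where \<sigma>: "\<sigma> \<kappa> \<in> bits t" "\<rho> \<kappa> = irrep t (\<sigma> \<kappa>)" if "\<kappa> < 2 ^ t" for \<kappa>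
    by metis
  have \<sigma>_neq: "\<sigma> \<kappa> \<noteq> \<sigma> \<mu>" if "\<kappa> < 2 ^ t" "\<mu> < 2 ^ t" "\<kappa> \<noteq> \<mu>" for \<kappa> \<mu>
    using bij_betw_imp_inj_on [OF \<rho>] \<sigma>(2) that by (metis inj_on_eq_iff lessThan_iff)
  show ?thesis
  proof (rule ex_basis_adapted_to_projections [where \<pi> = "\<lambda>\<kappa>. irrep_projection t n P (\<rho> \<kappa>)"])
    show "(\<Sum>\<kappa><2 ^ t. (irrep_projection t n P (\<rho> \<kappa>) *\<^sub>v v) $ i) = v $ i"
      if "v \<in> carrier_vec n" "i < n" for v i
    proof -
      have "(\<Sum>\<kappa><2 ^ t. (irrep_projection t n P (\<rho> \<kappa>) *\<^sub>v v) $ i) =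
          (\<Sum>r\<in>irrep t ` bits t. (irrep_projection t n P r *\<^sub>v v) $ i)"
        by (rule sum.reindex_bij_betw [OF \<rho>])
      also have "\<dots> = (\<Sum>\<kappa>\<in>bits t. (irrep_projection t n P (irrep t \<kappa>) *\<^sub>v v) $ i)"
        by (simp add: sum.reindex [OF inj_on_irrep])
      finally show ?thesis
        using sum_irrep_projection [OF P that] by simp
    qed
    show "irrep_projection t n P (\<rho> \<kappa>) *\<^sub>v v \<in> isotypic t n P (\<rho> \<kappa>)"
      if "\<kappa> < 2 ^ t" "v \<in> carrier_vec n" for \<kappa> v
      using irrep_projection_in_isotypic [OF P that(2)] \<sigma>(2) [OF that(1)] by simp
    show "irrep_projection t n P (\<rho> \<kappa>) *\<^sub>v w = w"
      if "\<kappa> < 2 ^ t" "w \<in> isotypic t n P (\<rho> \<kappa>)" for \<kappa> w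
      using irrep_projection_isotypic [OF P] \<sigma>(2) [OF that(1)] that(2) by simp
    show "irrep_projection t n P (\<rho> \<mu>) *\<^sub>v w = 0\<^sub>v n"
      if "\<kappa> < 2 ^ t" "\<mu> < 2 ^ t" "\<kappa> \<noteq> \<mu>" "w \<in> isotypic t n P (\<rho> \<kappa>)" for \<kappa> \<mu> w
      using irrep_projection_other [OF P \<sigma>(1) [OF that(1)] \<sigma>(1) [OF that(2)] \<sigma>_neq [OF that(1-3)]]
        \<sigma>(2) that by simp
    show "isotypic t n P (\<rho> \<kappa>) \<subseteq> carrier_vec n" for \<kappa>
      by (auto simp: isotypic_def)
  qed simp
qed

section \<open>Block-diagonal form in symmetry-adapted bases\<close>

lemma mat_of_labels_carrier [simp]:
  "mat_of_labels f rs cs \<in> carrier_mat (length rs) (length cs)"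
  by (simp add: mat_of_labels_def)

lemma mat_of_labels_append:
  "mat_of_labels f (rs @ rs') (cs @ cs') =
     four_block_mat (mat_of_labels f rs cs) (mat_of_labels f rs cs')
       (mat_of_labels f rs' cs) (mat_of_labels f rs' cs')"
  by (rule eq_matI) (auto simp: mat_of_labels_def nth_append)

text \<open>Splitting off the first group of rows and of columns leaves two zero blocks beside the
  remaining matrix. Groups may be empty or of unequal size. In the application the labels are basis
  vectors and \<open>f\<close> is the bilinear form of the rigidity matrix.\<close>

lemma mat_of_labels_concat:
  assumes "distinct ks"
    and "\<And>k l r c. k \<in> set ks \<Longrightarrow> l \<in> set ks \<Longrightarrow> k \<noteq> l \<Longrightarrow> r \<in> set (rs k) \<Longrightarrow> c \<in> set (cs l) \<Longrightarrow> f r c = 0"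
  shows "mat_of_labels f (concat (map rs ks)) (concat (map cs ks)) =
    diag_block_mat (map (\<lambda>k. mat_of_labels f (rs k) (cs k)) ks)"
  using assms
proof (induction ks)
  case Nil
  show ?case
    by (simp add: mat_of_labels_def, rule eq_matI) simp_all
next
  case (Cons k ks)
  let ?Rs = "concat (map rs ks)" and ?Cs = "concat (map cs ks)"
  have "mat_of_labels f (rs k) ?Cs = 0\<^sub>m (length (rs k)) (length ?Cs)"
  proof (rule eq_matI)
    fix i j assume "i < dim_row (0\<^sub>m (length (rs k)) (length ?Cs) :: real mat)"
      "j < dim_col (0\<^sub>m (length (rs k)) (length ?Cs) :: real mat)"
    then have i: "i < length (rs k)" and j: "j < length ?Cs"
      by simp_all
    from nth_mem [OF j] obtain l where "l \<in> set ks" "?Cs ! j \<in> set (cs l)"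
      by auto
    then have "f (rs k ! i) (?Cs ! j) = 0"
      using Cons.prems i by (intro Cons.prems(2) [of k l]) auto
    then show "mat_of_labels f (rs k) ?Cs $$ (i, j) = 0\<^sub>m (length (rs k)) (length ?Cs) $$ (i, j)"
      using i j by (simp add: mat_of_labels_def)
  qed (simp_all add: mat_of_labels_def)
  moreover have "mat_of_labels f ?Rs (cs k) = 0\<^sub>m (length ?Rs) (length (cs k))"
  proof (rule eq_matI)
    fix i j assume "i < dim_row (0\<^sub>m (length ?Rs) (length (cs k)) :: real mat)"
      "j < dim_col (0\<^sub>m (length ?Rs) (length (cs k)) :: real mat)"
    then have i: "i < length ?Rs" and j: "j < length (cs k)"
      by simp_all
    from nth_mem [OF i] obtain l where "l \<in> set ks" "?Rs ! i \<in> set (rs l)"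
      by auto
    then have "f (?Rs ! i) (cs k ! j) = 0"
      using Cons.prems j by (intro Cons.prems(2) [of l k]) auto
    then show "mat_of_labels f ?Rs (cs k) $$ (i, j) = 0\<^sub>m (length ?Rs) (length (cs k)) $$ (i, j)"
      using i j by (simp add: mat_of_labels_def)
  qed (simp_all add: mat_of_labels_def)
  moreover have "mat_of_labels f ?Rs ?Cs = diag_block_mat (map (\<lambda>k. mat_of_labels f (rs k) (cs k)) ks)"
    using Cons.prems by (intro Cons.IH) auto
  ultimately show ?case
    using mat_of_labels_carrier [of f ?Rs ?Cs] mat_of_labels_carrier [of f "rs k" "cs k"]
    by (simp add: mat_of_labels_append Let_def del: mat_of_labels_carrier)
qed

text \<open>Evaluate y^T P_Y(\<gamma>) R x twice. Symmetry of P_Y moves \<gamma> onto y and yields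
  the factor \<rho>(\<gamma>); equivariance moves it onto x and yields \<rho>'(\<gamma>). The
  factors differ.\<close>

lemma isotypic_bilinear_eq_zero:
  assumes PX: "bits_rep t nc PX" and PY: "bits_rep t nr PY"
    and R: "R \<in> carrier_mat nr nc"
    and equiv: "\<And>\<gamma>. \<gamma> \<in> bits t \<Longrightarrow> PY \<gamma> * R = R * PX \<gamma>"
    and sym: "\<And>\<gamma>. \<gamma> \<in> bits t \<Longrightarrow> (PY \<gamma>)\<^sup>T = PY \<gamma>"
    and neq: "\<gamma> \<in> bits t" "\<rho> \<gamma> \<noteq> \<rho>' \<gamma>"
    and y: "y \<in> isotypic t nr PY \<rho>" and x: "x \<in> isotypic t nc PX \<rho>'"
  shows "y \<bullet> (R *\<^sub>v x) = 0"
proof -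
  have yc: "y \<in> carrier_vec nr" and xc: "x \<in> carrier_vec nc"
    and Py: "PY \<gamma> *\<^sub>v y = \<rho> \<gamma> \<cdot>\<^sub>v y" and Px: "PX \<gamma> *\<^sub>v x = \<rho>' \<gamma> \<cdot>\<^sub>v x"
    using x y neq(1) by (auto simp: isotypic_def)
  have PXc: "PX \<gamma> \<in> carrier_mat nc nc" and PYc: "PY \<gamma> \<in> carrier_mat nr nr"
    using PX PY neq(1) by (auto simp: bits_rep_def)
  have Rx: "R *\<^sub>v x \<in> carrier_vec nr"
    using R xc by simp
  have "\<rho> \<gamma> * (y \<bullet> (R *\<^sub>v x)) = (PY \<gamma> *\<^sub>v y) \<bullet> (R *\<^sub>v x)"
    using yc Rx by (simp add: Py)
  also have "\<dots> = y \<bullet> (PY \<gamma> *\<^sub>v (R *\<^sub>v x))"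
    using transpose_vec_mult_scalar [OF PYc Rx yc] by (simp add: sym [OF neq(1)])
  also have "PY \<gamma> *\<^sub>v (R *\<^sub>v x) = R *\<^sub>v (PX \<gamma> *\<^sub>v x)"
    using assoc_mult_mat_vec [OF PYc R xc] assoc_mult_mat_vec [OF R PXc xc] equiv [OF neq(1)] by simp
  also have "\<dots> = \<rho>' \<gamma> \<cdot>\<^sub>v (R *\<^sub>v x)"
    using R xc by (simp add: Px mult_mat_vec)
  also have "y \<bullet> (\<rho>' \<gamma> \<cdot>\<^sub>v (R *\<^sub>v x)) = \<rho>' \<gamma> * (y \<bullet> (R *\<^sub>v x))"
    using yc Rx by simp
  finally show ?thesis
    using neq(2) by simp
qed

lemma equivariant_block_diagonalization:
  assumes PX: "bits_rep t nc PX" and PY: "bits_rep t nr PY"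
    and R: "R \<in> carrier_mat nr nc"
    and equiv: "\<And>\<gamma>. \<gamma> \<in> bits t \<Longrightarrow> PY \<gamma> * R = R * PX \<gamma>"
    and sym: "\<And>\<gamma>. \<gamma> \<in> bits t \<Longrightarrow> (PY \<gamma>)\<^sup>T = PY \<gamma>"
    and \<rho>: "bij_betw \<rho> {..<2 ^ t} (irrep t ` bits t)"
  shows "\<exists>A B. A \<in> carrier_mat nc nc \<and> invertible_mat A \<and>
     B \<in> carrier_mat nr nr \<and> invertible_mat B \<and>
     (\<exists>bX bY Rt.
        cols A = concat (map bX [0..<2 ^ t]) \<and>
        cols B = concat (map bY [0..<2 ^ t]) \<and>
        (\<forall>\<kappa><2 ^ t.
           basis_of nc (isotypic t nc PX (\<rho> \<kappa>)) (bX \<kappa>) \<and>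
           basis_of nr (isotypic t nr PY (\<rho> \<kappa>)) (bY \<kappa>) \<and>
           Rt \<kappa> \<in> carrier_mat (length (bY \<kappa>)) (length (bX \<kappa>))) \<and>
        B\<^sup>T * R * A = diag_block_mat (map Rt [0..<2 ^ t]))"
proof -
  obtain bX where bX: "\<forall>\<kappa><2 ^ t. basis_of nc (isotypic t nc PX (\<rho> \<kappa>)) (bX \<kappa>)"
    "basis_of nc (carrier_vec nc) (concat (map bX [0..<2 ^ t]))"
    using ex_symmetry_adapted_basis [OF PX \<rho>] by blast
  obtain bY where bY: "\<forall>\<kappa><2 ^ t. basis_of nr (isotypic t nr PY (\<rho> \<kappa>)) (bY \<kappa>)"
    "basis_of nr (carrier_vec nr) (concat (map bY [0..<2 ^ t]))"
    using ex_symmetry_adapted_basis [OF PY \<rho>] by blast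
  let ?xs = "concat (map bX [0..<2 ^ t])" and ?ys = "concat (map bY [0..<2 ^ t])"
  define A where "A = mat_of_cols nc ?xs"
  define B where "B = mat_of_cols nr ?ys"
  define Rt where "Rt = (\<lambda>\<kappa>. mat_of_labels (\<lambda>y x. y \<bullet> (R *\<^sub>v x)) (bY \<kappa>) (bX \<kappa>))"
  have A: "A \<in> carrier_mat nc nc" "invertible_mat A" "cols A = ?xs"
    unfolding A_def by (rule basis_of_carrier_vec_invertible [OF bX(2)])+
  have B: "B \<in> carrier_mat nr nr" "invertible_mat B" "cols B = ?ys"
    unfolding B_def by (rule basis_of_carrier_vec_invertible [OF bY(2)])+
  \<comment> \<open>Taking the columns themselves as labels exposes each entry as y^T R x, so that
    the grouping by irreducible representation can be applied.\<close>
  have "B\<^sup>T * R * A = mat_of_labels (\<lambda>y x. y \<bullet> (R *\<^sub>v x)) (cols B) (cols A)"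
  proof (rule eq_matI)
    fix i j assume "i < dim_row (mat_of_labels (\<lambda>y x. y \<bullet> (R *\<^sub>v x)) (cols B) (cols A))"
      "j < dim_col (mat_of_labels (\<lambda>y x. y \<bullet> (R *\<^sub>v x)) (cols B) (cols A))"
    then have i: "i < nr" and j: "j < nc"
      using A(1) B(1) by (simp_all add: mat_of_labels_def)
    have "B\<^sup>T * R * A = B\<^sup>T * (R * A)"
      using A(1) B(1) R by (intro assoc_mult_mat) auto
    then have "(B\<^sup>T * R * A) $$ (i, j) = row (B\<^sup>T) i \<bullet> col (R * A) j"
      using i j A(1) B(1) R by simp
    also have "\<dots> = col B i \<bullet> (R *\<^sub>v col A j)"
      using i j A(1) B(1) R by (simp add: col_mult2 [OF R A(1) j])
    finally show "(B\<^sup>T * R * A) $$ (i, j) =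
        mat_of_labels (\<lambda>y x. y \<bullet> (R *\<^sub>v x)) (cols B) (cols A) $$ (i, j)"
      using i j A(1) B(1) by (simp add: mat_of_labels_def)
  qed (use A(1) B(1) R in \<open>simp_all add: mat_of_labels_def\<close>)
  also have "\<dots> = diag_block_mat (map Rt [0..<2 ^ t])"
    unfolding A(3) B(3) Rt_def
  proof (rule mat_of_labels_concat)
    fix \<kappa> \<mu> y x
    assume "\<kappa> \<in> set [0..<2 ^ t]" "\<mu> \<in> set [0..<2 ^ t]" and neq: "\<kappa> \<noteq> \<mu>"
      and y: "y \<in> set (bY \<kappa>)" and x: "x \<in> set (bX \<mu>)"
    then have \<kappa>\<mu>: "\<kappa> < 2 ^ t" "\<mu> < 2 ^ t"
      by simp_all
    have in_W: "v \<in> W" if "basis_of n W bs" "v \<in> set bs" for n W bs and v :: "real vec"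
    proof -
      interpret vec_space "TYPE(real)" n .
      show ?thesis
        using that in_own_span [of "set bs"] by (auto simp: basis_of_def)
    qed
    obtain \<sigma> \<sigma>' where \<sigma>: "\<sigma> \<in> bits t" "\<sigma>' \<in> bits t" "\<rho> \<kappa> = irrep t \<sigma>" "\<rho> \<mu> = irrep t \<sigma>'"
      using bij_betw_apply [OF \<rho>] \<kappa>\<mu> by (metis imageE lessThan_iff)
    have "\<rho> \<kappa> \<noteq> \<rho> \<mu>"
      using bij_betw_imp_inj_on [OF \<rho>] \<kappa>\<mu> neq by (auto dest: inj_onD)
    then obtain \<gamma> where "\<gamma> \<in> bits t" "\<rho> \<kappa> \<gamma> \<noteq> \<rho> \<mu> \<gamma>"
      using irrep_separates [OF \<sigma>(1,2)] \<sigma>(3,4) by auto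
    then show "y \<bullet> (R *\<^sub>v x) = 0"
      using isotypic_bilinear_eq_zero [OF PX PY R equiv sym] in_W bX(1) bY(1) \<kappa>\<mu> x y by blast
  qed simp
  finally have "B\<^sup>T * R * A = diag_block_mat (map Rt [0..<2 ^ t])" .
  moreover have "Rt \<kappa> \<in> carrier_mat (length (bY \<kappa>)) (length (bX \<kappa>))" for \<kappa>
    by (simp add: Rt_def)
  ultimately show ?thesis
    using A B bX(1) bY(1) by blast
qed

section \<open>The extrusion action\<close>

declare add_bit_eq_xor [simp del] \<comment> \<open>it would turn every sum of bits into an \<open>of_bool\<close> term\<close>

definition unit_bits :: "nat \<Rightarrow> nat \<Rightarrow> bit list" where
  "unit_bits t h = (replicate t 0)[h := 1]"

lemma unit_bits_in_bits [simp]: "unit_bits t h \<in> bits t"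
  by (simp add: unit_bits_def bits_def)

lemma nth_unit_bits: "g < t \<Longrightarrow> unit_bits t h ! g = (if g = h then 1 else 0)"
  by (simp add: unit_bits_def nth_list_update)

lemma fst_act [simp]: "fst (act \<gamma> i) = fst i"
  by (simp add: act_def split: prod.splits)

lemma length_snd_act [simp]: "length (snd (act \<gamma> i)) = min (length (snd i)) (length \<gamma>)"
  by (simp add: act_def split: prod.splits)

lemma nth_snd_act [simp]:
  "h < length (snd i) \<Longrightarrow> h < length \<gamma> \<Longrightarrow> snd (act \<gamma> i) ! h = map_option (\<lambda>c. c + \<gamma> ! h) (snd i ! h)"
  by (cases i) (simp add: act_def)

lemma evert_eqI:
  assumes "fst i = fst j" "length (snd i) = length (snd j)"
    "\<And>h. h < length (snd i) \<Longrightarrow> snd i ! h = snd j ! h"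
  shows "i = j"
  using assms by (intro prod_eqI nth_equalityI) auto

text \<open>The length assumption matters because \<open>act\<close> zips two lists and would
  truncate; a star stays a star since \<open>map_option\<close> fixes \<open>None\<close>.\<close>

lemma act_act:
  assumes "length (snd i) = t" "\<gamma> \<in> bits t" "\<delta> \<in> bits t"
  shows "act \<gamma> (act \<delta> i) = act (add_bits \<gamma> \<delta>) i"
  by (rule evert_eqI) (use assms in \<open>auto simp: bits_def option.map_comp o_def ac_simps\<close>)

lemma act_zero:
  assumes "length (snd i) = t"
  shows "act (replicate t 0) i = i"
  by (rule evert_eqI) (use assms in \<open>simp_all add: option.map_ident\<close>)

lemma act_involution:
  assumes "length (snd i) = t" "\<gamma> \<in> bits t"
  shows "act \<gamma> (act \<gamma> i) = i"
  using act_act [OF assms assms(2)] act_zero [OF assms(1)] assms(2)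
  by (simp add: add_bits_self bits_def)

lemma fst_contract [simp]: "fst (contract F w) = fst w"
  by (simp add: contract_def split: prod.splits)

lemma length_snd_contract [simp]: "length (snd (contract F w)) = length (snd w)"
  by (simp add: contract_def split: prod.splits)

lemma nth_snd_contract [simp]:
  "h < length (snd w) \<Longrightarrow> snd (contract F w) ! h = (if fst w \<in> F h then None else Some (snd w ! h))"
  by (cases w) (simp add: contract_def)

lemma act_contract:
  assumes "x \<in> bits t" "\<gamma> \<in> bits t"
  shows "act \<gamma> (contract F (u, x)) = contract F (u, add_bits x \<gamma>)"
  by (rule evert_eqI) (use assms in \<open>auto simp: bits_def\<close>)

lemma differ_exactly_at_add_bits:
  assumes "differ_exactly_at h x y" "length \<gamma> = length x"
  shows "differ_exactly_at h (add_bits x \<gamma>) (add_bits y \<gamma>)"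
  using assms by (auto simp: differ_exactly_at_def)

lemma differ_exactly_at_contract:
  assumes "differ_exactly_at h x y" "u \<notin> F h"
  shows "differ_exactly_at h (snd (contract F (u, x))) (snd (contract F (u, y)))"
  using assms by (auto simp: differ_exactly_at_def)

lemma other_end_card_2:
  assumes "card e = 2" "k \<in> e"
  shows "e = {k, other_end e k}" "other_end e k \<noteq> k"
proof -
  obtain l where "e = {k, l}" "l \<noteq> k"
    using assms by (auto simp: card_2_iff)
  moreover from this have "e - {k} = {l}"
    by auto
  ultimately show "e = {k, other_end e k}" "other_end e k \<noteq> k"
    by (simp_all add: other_end_def)
qed

lemma other_end_eqI: "e = {k, l} \<Longrightarrow> k \<noteq> l \<Longrightarrow> other_end e k = l"
  using other_end_card_2 [of e k] by (auto simp: doubleton_eq_iff)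

lemma extruded_edgeI:
  assumes "fst i = fst j" "differ_exactly_at h (snd i) (snd j)"
  shows "extruded_edge h {i, j}"
  unfolding extruded_edge_def
  by (rule exI [of _ "fst i"], rule exI [of _ "snd i"], rule exI [of _ "snd j"])
    (use assms in \<open>cases i; cases j; simp\<close>)

lemma extruded_edge_unique:
  assumes "extruded_edge h e" "extruded_edge h' e"
  shows "h = h'"
proof -
  obtain u x y where 1: "e = {(u, x), (u, y)}" "differ_exactly_at h x y"
    using assms(1) by (auto simp: extruded_edge_def)
  obtain u' x' y' where 2: "e = {(u', x'), (u', y')}" "differ_exactly_at h' x' y'"
    using assms(2) by (auto simp: extruded_edge_def)
  have "{x, y} = {x', y'}"
    using 1(1) 2(1) by (auto simp: doubleton_eq_iff)
  then show ?thesis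
    using 1(2) 2(2) unfolding differ_exactly_at_def doubleton_eq_iff by metis
qed

section \<open>The extrusion graph and its edge orbits\<close>

locale extrusion =
  fixes t :: nat and F :: "nat \<Rightarrow> 'v set" and H :: "'v ph_graph" and G :: "'v evert ph_graph"
  assumes H: "ph_graph H"
    and F_hyps: "\<And>h. h < t \<Longrightarrow> F h \<subseteq> hyps H"
    and G_eq: "G = extrusion_graph t F H"
begin

lemma points_eq: "points G = contract F ` (points H \<times> bits t)"
  and hyps_eq: "hyps G = contract F ` (hyps H \<times> bits t)"
  by (simp_all add: G_eq extrusion_graph_def)

lemma vertsE:
  assumes "i \<in> verts G"
  obtains u x where "u \<in> verts H" "x \<in> bits t" "i = contract F (u, x)"
  using assms by (auto simp: verts_def points_eq hyps_eq)

lemma fst_points: "i \<in> points G \<Longrightarrow> fst i \<in> points H"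
  and fst_hyps: "i \<in> hyps G \<Longrightarrow> fst i \<in> hyps H"
  by (auto simp: points_eq hyps_eq)

lemma points_hyps_disjoint: "points G \<inter> hyps G = {}"
  using H fst_points fst_hyps unfolding ph_graph_def by blast

lemma points_in_verts: "i \<in> points G \<Longrightarrow> i \<in> verts G"
  and hyps_in_verts: "i \<in> hyps G \<Longrightarrow> i \<in> verts G"
  by (simp_all add: verts_def)

lemma length_snd_verts: "i \<in> verts G \<Longrightarrow> length (snd i) = t"
  by (elim vertsE) (simp add: bits_def)

lemma star_iff: "i \<in> verts G \<Longrightarrow> h < t \<Longrightarrow> snd i ! h = None \<longleftrightarrow> fst i \<in> F h"
  by (elim vertsE) (simp add: bits_def)

text \<open>The contracted sets consist of hyperplane vertices of H, and the two vertex types of H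
  are disjoint.\<close>

lemma no_star_points:
  assumes "i \<in> points G" "h < t"
  shows "snd i ! h \<noteq> None"
proof -
  have "fst i \<notin> F h"
    using fst_points [OF assms(1)] F_hyps [OF assms(2)] H unfolding ph_graph_def by blast
  then show ?thesis
    using star_iff [OF points_in_verts [OF assms(1)] assms(2)] by simp
qed

lemma act_points: "\<gamma> \<in> bits t \<Longrightarrow> i \<in> points G \<Longrightarrow> act \<gamma> i \<in> points G"
  and act_hyps: "\<gamma> \<in> bits t \<Longrightarrow> i \<in> hyps G \<Longrightarrow> act \<gamma> i \<in> hyps G"
  unfolding points_eq hyps_eq by (auto simp: act_contract)

lemma act_verts: "\<gamma> \<in> bits t \<Longrightarrow> i \<in> verts G \<Longrightarrow> act \<gamma> i \<in> verts G"
  using act_points [of \<gamma> i] act_hyps [of \<gamma> i] unfolding verts_def by blast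

lemma act_act_verts: "i \<in> verts G \<Longrightarrow> \<gamma> \<in> bits t \<Longrightarrow> act \<gamma> (act \<gamma> i) = i"
  using act_involution length_snd_verts by blast

lemma inj_on_act: "\<gamma> \<in> bits t \<Longrightarrow> inj_on (act \<gamma>) (verts G)"
  by (rule inj_on_inverseI [where g = "act \<gamma>"]) (simp add: act_act_verts)

lemma edgesE:
  assumes "e \<in> edges G"
  obtains (base) u v x where "{u, v} \<in> edges H" "u \<noteq> v" "x \<in> bits t"
      "e = {contract F (u, x), contract F (v, x)}"
    | (extruded) u x y h where "u \<in> verts H" "h < t" "u \<notin> F h" "x \<in> bits t" "y \<in> bits t"
      "differ_exactly_at h x y" "e = {contract F (u, x), contract F (u, y)}"
proof -
  obtain e' where e': "e' \<in> prism_edges t H" "e = contract F ` e'" "card e = 2"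
    using assms by (auto simp: G_eq extrusion_graph_def)
  from e'(1) consider
      u v x where "e' = {(u, x), (v, x)}" "{u, v} \<in> edges H" "x \<in> bits t"
    | u x y h where "e' = {(u, x), (u, y)}" "u \<in> verts H" "x \<in> bits t" "y \<in> bits t" "h < t"
        "differ_exactly_at h x y"
    unfolding prism_edges_def by blast
  then show ?thesis
  proof cases
    case 1
    then have "u \<noteq> v"
      using e' by auto
    then show ?thesis
      using 1 e'(2) base by simp
  next
    case 2
    \<comment> \<open>For u in F h the contraction erases the only coordinate in which x and y
      differ, so the edge would collapse to a singleton.\<close>
    have "u \<notin> F h"
    proof
      assume "u \<in> F h"
      then have "contract F (u, x) = contract F (u, y)"
        using 2 by (intro evert_eqI) (auto simp: bits_def differ_exactly_at_def)
      then show False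
        using e' 2(1) by simp
    qed
    then show ?thesis
      using 2 e'(2) extruded by simp
  qed
qed

lemma card_edge: "e \<in> edges G \<Longrightarrow> card e = 2"
  by (simp add: G_eq extrusion_graph_def)

lemma edge_subset_verts: "e \<in> edges G \<Longrightarrow> e \<subseteq> verts G"
proof (erule edgesE)
  fix u v x assume "{u, v} \<in> edges H" "x \<in> bits t" "e = {contract F (u, x), contract F (v, x)}"
  moreover have "{u, v} \<subseteq> verts H"
    using H \<open>{u, v} \<in> edges H\<close> unfolding ph_graph_def by (metis empty_subsetI insert_subset)
  ultimately show "e \<subseteq> verts G"
    by (auto simp: verts_def points_eq hyps_eq)
next
  fix u x y assume "u \<in> verts H" "x \<in> bits t" "y \<in> bits t" "e = {contract F (u, x), contract F (u, y)}"
  then show "e \<subseteq> verts G"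
    by (auto simp: verts_def points_eq hyps_eq)
qed

text \<open>An edge is lifted to the prism and translated there; contraction commutes with
  translation by \<open>act_contract\<close>, and injectivity of the action prevents
  collapse.\<close>

lemma act_edges:
  assumes \<gamma>: "\<gamma> \<in> bits t" and e: "e \<in> edges G"
  shows "act \<gamma> ` e \<in> edges G"
proof -
  have "card (act \<gamma> ` e) = 2"
    using card_image [OF inj_on_subset [OF inj_on_act [OF \<gamma>] edge_subset_verts [OF e]]] card_edge [OF e]
    by simp
  moreover have "\<exists>e'\<in>prism_edges t H. act \<gamma> ` e = contract F ` e'"
    using e
  proof (cases rule: edgesE)
    case (base u v x)
    then have "act \<gamma> ` e = contract F ` {(u, add_bits x \<gamma>), (v, add_bits x \<gamma>)}"
      using \<gamma> by (simp add: act_contract)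
    moreover have "{(u, add_bits x \<gamma>), (v, add_bits x \<gamma>)} \<in> prism_edges t H"
      unfolding prism_edges_def
      by (intro UnI1 CollectI exI [of _ u] exI [of _ v] exI [of _ "add_bits x \<gamma>"])
        (simp add: base \<gamma>)
    ultimately show ?thesis by (rule bexI)
  next
    case (extruded u x y h)
    then have "act \<gamma> ` e = contract F ` {(u, add_bits x \<gamma>), (u, add_bits y \<gamma>)}"
      using \<gamma> by (simp add: act_contract)
    moreover have "differ_exactly_at h (add_bits x \<gamma>) (add_bits y \<gamma>)"
      using extruded \<gamma> by (intro differ_exactly_at_add_bits) (simp_all add: bits_def)
    then have "{(u, add_bits x \<gamma>), (u, add_bits y \<gamma>)} \<in> prism_edges t H"
      unfolding prism_edges_def
      by (intro UnI2 CollectI exI [of _ u] exI [of _ "add_bits x \<gamma>"] exI [of _ "add_bits y \<gamma>"])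
        (use extruded \<gamma> in auto)
    ultimately show ?thesis by (rule bexI)
  qed
  ultimately show ?thesis
    by (auto simp: G_eq extrusion_graph_def)
qed

lemma length_snd_edge: "e \<in> edges G \<Longrightarrow> i \<in> e \<Longrightarrow> length (snd i) = t"
  using edge_subset_verts length_snd_verts by blast

lemma act_act_edge:
  assumes "e \<in> edges G" "\<gamma> \<in> bits t" "\<delta> \<in> bits t"
  shows "act \<gamma> ` act \<delta> ` e = act (add_bits \<gamma> \<delta>) ` e"
  unfolding image_image
proof (rule image_cong)
  fix i assume "i \<in> e"
  then show "act \<gamma> (act \<delta> i) = act (add_bits \<gamma> \<delta>) i"
    by (rule act_act [OF length_snd_edge [OF assms(1)] assms(2,3)])
qed simp

lemma act_zero_edge:
  assumes "e \<in> edges G"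
  shows "act (replicate t 0) ` e = e"
proof -
  have "act (replicate t 0) ` e = (\<lambda>i. i) ` e"
    by (rule image_cong) (simp_all add: act_zero length_snd_edge [OF assms])
  then show ?thesis
    by simp
qed

lemma mem_act_edge_iff:
  assumes "e \<in> edges G" "\<gamma> \<in> bits t" "i \<in> verts G"
  shows "i \<in> act \<gamma> ` e \<longleftrightarrow> act \<gamma> i \<in> e"
proof
  assume "i \<in> act \<gamma> ` e"
  then obtain k where k: "k \<in> e" "i = act \<gamma> k"
    by blast
  moreover from this have "k \<in> verts G"
    using edge_subset_verts [OF assms(1)] by blast
  ultimately show "act \<gamma> i \<in> e"
    using act_act_verts assms(2) by simp
next
  assume "act \<gamma> i \<in> e"
  then show "i \<in> act \<gamma> ` e"
    using act_act_verts [OF assms(3,2)] by force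
qed

lemma other_end_in_edge:
  assumes "e \<in> edges G" "k \<in> e"
  shows "other_end e k \<in> e"
  by (subst other_end_card_2(1) [OF card_edge [OF assms(1)] assms(2)]) simp

lemma other_end_act:
  assumes "e \<in> edges G" "\<gamma> \<in> bits t" "k \<in> e"
  shows "other_end (act \<gamma> ` e) (act \<gamma> k) = act \<gamma> (other_end e k)"
proof (rule other_end_eqI)
  note oe = other_end_card_2 [OF card_edge [OF assms(1)] assms(3)]
  show "act \<gamma> ` e = {act \<gamma> k, act \<gamma> (other_end e k)}"
    using arg_cong [OF oe(1), of "image (act \<gamma>)"] by simp
  show "act \<gamma> k \<noteq> act \<gamma> (other_end e k)"
    using oe(2) inj_onD [OF inj_on_act [OF assms(2)], of k "other_end e k"]
      edge_subset_verts [OF assms(1)] other_end_in_edge [OF assms(1,3)] assms(3) by auto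
qed

text \<open>This replaces an extruded edge by a translation along a unit vector, so that the
  difference of its ends can be computed from the symmetry conditions.\<close>

lemma extruded_other_end:
  assumes e: "e \<in> edges G" and h: "extruded_edge h e" and k: "k \<in> e"
  shows "h < t" "snd k ! h \<noteq> None" "other_end e k = act (unit_bits t h) k"
proof -
  obtain u x y where uxy: "e = {(u, x), (u, y)}" "differ_exactly_at h x y"
    using h by (auto simp: extruded_edge_def)
  then have "x \<noteq> y"
    by (auto simp: differ_exactly_at_def)
  have len: "length x = t" "length y = t"
    using edge_subset_verts [OF e] length_snd_verts uxy(1) by force+
  show ht: "h < t"
    using uxy(2) len by (simp add: differ_exactly_at_def)
  obtain x' y' where k': "k = (u, x')" "e = {(u, x'), (u, y')}" "differ_exactly_at h x' y'" "x' \<noteq> y'"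
    "length x' = t" "length y' = t"
  proof -
    from k uxy(1) consider "k = (u, x)" | "k = (u, y)"
      by auto
    then show ?thesis
    proof cases
      case 1
      then show ?thesis
        using that [of x y] uxy \<open>x \<noteq> y\<close> len by simp
    next
      case 2
      have "differ_exactly_at h y x"
        using uxy(2) by (auto simp: differ_exactly_at_def)
      then show ?thesis
        using 2 that [of y x] uxy(1) \<open>x \<noteq> y\<close> len by (simp add: insert_commute)
    qed
  qed
  have v: "(u, x') \<in> verts G" "(u, y') \<in> verts G"
    using edge_subset_verts [OF e] k'(2) by auto
  \<comment> \<open>By itself, \<open>extruded_edge\<close> would admit a star at one end and a bit
    at the other. Ends over the same vertex of H have their stars in the same places, so two
    distinct bits remain.\<close>
  have "x' ! h = None \<longleftrightarrow> y' ! h = None"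
    using star_iff [OF v(1) ht] star_iff [OF v(2) ht] by simp
  moreover have ne: "x' ! h \<noteq> y' ! h"
    using k'(3) ht k'(5) by (auto simp: differ_exactly_at_def)
  ultimately obtain b c where bc: "x' ! h = Some b" "y' ! h = Some c" "b \<noteq> c"
    by auto
  then show "snd k ! h \<noteq> None"
    by (simp add: k'(1))
  have "(u, y') = act (unit_bits t h) (u, x')"
  proof (rule evert_eqI)
    fix g assume "g < length (snd (u, y'))"
    then have g: "g < t"
      using k' by simp
    have "b + 1 = c"
      using bc(3) by (cases b; cases c) auto
    then show "snd (u, y') ! g = snd (act (unit_bits t h) (u, x')) ! g"
      using k'(3,5) g bc by (cases "g = h")
        (auto simp: nth_unit_bits unit_bits_def differ_exactly_at_def option.map_ident)
  qed (simp_all add: k'(5,6) unit_bits_def)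
  moreover have "other_end e (u, x') = (u, y')"
    by (rule other_end_eqI [OF k'(2)]) (simp add: k'(4))
  ultimately show "other_end e k = act (unit_bits t h) k"
    by (simp add: k'(1))
qed

text \<open>Both ends are contractions of copies with the same bit list, hence agree wherever
  neither has a star. Star patterns may differ, since the ends lie over different vertices of
  H.\<close>

lemma not_extruded_edge:
  assumes e: "e \<in> edges G" and "\<And>h. \<not> extruded_edge h e" and k: "k \<in> e"
  shows "card (fst ` e) = 2"
    "h < t \<Longrightarrow> snd k ! h \<noteq> None \<Longrightarrow> snd (other_end e k) ! h \<noteq> None \<Longrightarrow> snd (other_end e k) ! h = snd k ! h"
proof -
  have *: "card (fst ` e) = 2 \<and> (\<forall>k\<in>e. \<forall>l\<in>e. \<forall>h<t. snd k ! h \<noteq> None \<longrightarrow> snd l ! h \<noteq> None \<longrightarrow> snd k ! h = snd l ! h)"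
    using e
  proof (cases rule: edgesE)
    case (base u v x)
    have "snd k ! h = Some (x ! h)" if "k \<in> e" "h < t" "snd k ! h \<noteq> None" for k h
    proof -
      obtain w where "k = contract F (w, x)"
        using base(4) \<open>k \<in> e\<close> by auto
      then show ?thesis
        using that(2,3) base(3) by (simp add: bits_def split: if_splits)
    qed
    moreover have "card (fst ` e) = 2"
      using base(2) by (simp add: base(4))
    ultimately show ?thesis
      by metis
  next
    case (extruded u x y h)
    have "differ_exactly_at h (snd (contract F (u, x))) (snd (contract F (u, y)))"
      by (rule differ_exactly_at_contract [where F = F, OF extruded(6,3)])
    then have "extruded_edge h e"
      unfolding extruded(7) by (intro extruded_edgeI) simp_all
    then show ?thesis
      using assms(2) by blast
  qed
  then show "card (fst ` e) = 2" by simp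
  show "snd (other_end e k) ! h = snd k ! h"
    if "h < t" "snd k ! h \<noteq> None" "snd (other_end e k) ! h \<noteq> None"
    using *[THEN conjunct2, rule_format, OF k other_end_in_edge [OF e k] that] by simp
qed

text \<open>Adding a fixed bit is injective on optional bits, so it neither creates nor removes
  differences; the converse direction applies the involution again.\<close>

lemma extruded_edge_act:
  assumes e: "e \<in> edges G" and \<gamma>: "\<gamma> \<in> bits t"
  shows "extruded_edge h (act \<gamma> ` e) \<longleftrightarrow> extruded_edge h e"
proof -
  have imp: "extruded_edge h (act \<gamma> ` e)" if e: "e \<in> edges G" and h: "extruded_edge h e" for e
  proof -
    obtain u x y where uxy: "e = {(u, x), (u, y)}" "differ_exactly_at h x y"
      using h by (auto simp: extruded_edge_def)
    have len: "length x = t" "length y = t"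
      using edge_subset_verts [OF e] length_snd_verts uxy(1) by force+
    have "snd (act \<gamma> (u, x)) ! g = snd (act \<gamma> (u, y)) ! g \<longleftrightarrow> x ! g = y ! g" if "g < t" for g
      using len \<gamma> that
      by (simp add: bits_def inj_eq [OF option.inj_map] inj_def)
    then have "differ_exactly_at h (snd (act \<gamma> (u, x))) (snd (act \<gamma> (u, y)))"
      using uxy(2) len \<gamma> by (simp add: differ_exactly_at_def bits_def)
    then show ?thesis
      unfolding uxy(1) image_insert image_empty by (intro extruded_edgeI) simp_all
  qed
  have "act \<gamma> ` act \<gamma> ` e = e"
    using act_act_edge [OF e \<gamma> \<gamma>] act_zero_edge [OF e] \<gamma> by (simp add: add_bits_self bits_def)
  then show ?thesis
    using imp [OF e] imp [OF act_edges [OF \<gamma> e]] by auto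
qed

lemma extruded_edge_less:
  assumes "e \<in> edges G" "extruded_edge h e"
  shows "h < t"
proof -
  obtain k where "k \<in> e"
    using card_edge [OF assms(1)] by (auto simp: card_2_iff)
  then show ?thesis
    by (rule extruded_other_end(1) [OF assms])
qed

lemma edge_sign_extruded:
  assumes "e \<in> edges G" "extruded_edge h e" "\<gamma> \<in> bits t"
  shows "edge_sign \<gamma> e = (if \<gamma> ! h = 1 then -1 else 1)"
proof -
  have "extruded_edge h' e \<longleftrightarrow> h' = h" for h'
    using extruded_edge_unique assms(2) by blast
  then show ?thesis
    using extruded_edge_less [OF assms(1,2)] assms(3) by (simp add: edge_sign_def bits_def)
qed

lemma edge_sign_not_extruded: "(\<And>h. \<not> extruded_edge h e) \<Longrightarrow> edge_sign \<gamma> e = 1"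
  by (simp add: edge_sign_def)

lemma edge_sign_act: "e \<in> edges G \<Longrightarrow> \<delta> \<in> bits t \<Longrightarrow> edge_sign \<gamma> (act \<delta> ` e) = edge_sign \<gamma> e"
  by (simp add: edge_sign_def extruded_edge_act)

lemma edge_sign_zero: "edge_sign (replicate t 0) e = 1"
  by (simp add: edge_sign_def)

text \<open>For an edge extruded in direction h the sign is the character (-1)^(\<gamma>_h) of the
  group, and for all other edges it is the trivial character.\<close>

lemma edge_sign_add:
  assumes "e \<in> edges G" "\<gamma> \<in> bits t" "\<delta> \<in> bits t"
  shows "edge_sign (add_bits \<gamma> \<delta>) e = edge_sign \<gamma> e * edge_sign \<delta> e"
proof (cases "\<exists>h. extruded_edge h e")
  case True
  then obtain h where h: "extruded_edge h e" ..
  have "h < t"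
    by (rule extruded_edge_less [OF assms(1) h])
  then have "add_bits \<gamma> \<delta> ! h = \<gamma> ! h + \<delta> ! h"
    using assms by (simp add: bits_def)
  then show ?thesis
    using assms by (cases "\<gamma> ! h"; cases "\<delta> ! h") (simp_all add: edge_sign_extruded [OF _ h])
next
  case False
  then show ?thesis
    by (simp add: edge_sign_not_extruded)
qed

end

section \<open>The internal and external representations\<close>

lemma mat_of_labels_cong:
  "(\<And>r c. r \<in> set rs \<Longrightarrow> c \<in> set cs \<Longrightarrow> f r c = g r c) \<Longrightarrow> mat_of_labels f rs cs = mat_of_labels g rs cs"
  by (rule eq_matI) (auto simp: mat_of_labels_def)

lemma mat_of_labels_mult:
  assumes "distinct xs"
  shows "mat_of_labels f rs xs * mat_of_labels g xs cs =
    mat_of_labels (\<lambda>r c. \<Sum>x\<in>set xs. f r x * g x c) rs cs"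
proof (rule eq_matI)
  fix i j assume "i < dim_row (mat_of_labels (\<lambda>r c. \<Sum>x\<in>set xs. f r x * g x c) rs cs)"
    "j < dim_col (mat_of_labels (\<lambda>r c. \<Sum>x\<in>set xs. f r x * g x c) rs cs)"
  then have ij: "i < length rs" "j < length cs"
    by (simp_all add: mat_of_labels_def)
  have "(mat_of_labels f rs xs * mat_of_labels g xs cs) $$ (i, j) =
      (\<Sum>k\<in>{..<length xs}. f (rs ! i) (xs ! k) * g (xs ! k) (cs ! j))"
    using ij by (simp add: mat_of_labels_def scalar_prod_def atLeast0LessThan)
  also have "\<dots> = (\<Sum>x\<in>set xs. f (rs ! i) x * g x (cs ! j))"
    by (rule sum.reindex_bij_betw [OF bij_betw_nth [OF assms refl refl]])
  finally show "(mat_of_labels f rs xs * mat_of_labels g xs cs) $$ (i, j) =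
      mat_of_labels (\<lambda>r c. \<Sum>x\<in>set xs. f r x * g x c) rs cs $$ (i, j)"
    using ij by (simp add: mat_of_labels_def)
qed (simp_all add: mat_of_labels_def)

lemma mat_of_labels_one:
  "distinct xs \<Longrightarrow> mat_of_labels (\<lambda>r c. if r = c then 1 else 0) xs xs = 1\<^sub>m (length xs)"
  by (rule eq_matI) (auto simp: mat_of_labels_def nth_eq_iff_index_eq)

lemma mat_of_labels_transpose: "(mat_of_labels f rs cs)\<^sup>T = mat_of_labels (\<lambda>c r. f r c) cs rs"
  by (rule eq_matI) (auto simp: mat_of_labels_def)

lemma add_bits_commute: "add_bits \<gamma> \<delta> = add_bits \<delta> \<gamma>"
  by (rule nth_equalityI) (simp_all add: add.commute)

text \<open>The coefficient of one extrusion direction in \<open>shift\<close>, which merges the two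
  index sets X and Y into one sum. Read as integers, it is the bit after translation minus the bit
  before, and 0 at a star.\<close>

definition shift_coeff :: "bit option \<Rightarrow> bit \<Rightarrow> real" where
  "shift_coeff b g = (if b = Some 0 \<and> g = 1 then 1 else if b = Some 1 \<and> g = 1 then -1 else 0)"

lemma shift_coeff_zero [simp]: "shift_coeff b 0 = 0"
  by (simp add: shift_coeff_def)

text \<open>The differences of new and old bit telescope: first translate by g', then by g from the
  new position.\<close>

lemma shift_coeff_add:
  "shift_coeff b (g + g') = shift_coeff b g' + shift_coeff (map_option (\<lambda>c. c + g') b) g"
proof (cases b)
  case (Some c)
  then show ?thesis
    by (cases c; cases g; cases g') (simp_all add: shift_coeff_def)
qed (simp add: shift_coeff_def)

text \<open>Adding 1 exchanges the bits 0 and 1 and so reverses the direction of travel. This is the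
  origin of the sign on extruded edges between points.\<close>

lemma shift_coeff_flip:
  "b \<noteq> None \<Longrightarrow> shift_coeff (map_option (\<lambda>c. c + g) b) 1 = (if g = 1 then -1 else 1) * shift_coeff b 1"
proof -
  assume "b \<noteq> None"
  then obtain c where "b = Some c" by blast
  then show ?thesis
    by (cases c; cases g) (simp_all add: shift_coeff_def)
qed

lemma shift_carrier:
  assumes "\<And>h. h < t \<Longrightarrow> \<tau> h \<in> carrier_vec d" "\<gamma> \<in> bits t"
  shows "shift d \<tau> \<gamma> i \<in> carrier_vec d"
  unfolding shift_def
  by (intro minus_carrier_vec finsum_vec_closed) (use assms in \<open>auto simp: bits_def\<close>)

lemma shift_index:
  assumes \<tau>: "\<And>h. h < t \<Longrightarrow> \<tau> h \<in> carrier_vec d" and \<gamma>: "\<gamma> \<in> bits t" and c: "c < d"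
  shows "shift d \<tau> \<gamma> i $ c = (\<Sum>h<t. shift_coeff (snd i ! h) (\<gamma> ! h) * \<tau> h $ c)"
proof -
  have len: "length \<gamma> = t"
    using \<gamma> by (simp add: bits_def)
  have *: "finsum_vec TYPE(real) d \<tau> {h. h < t \<and> P h} $ c = (\<Sum>h<t. if P h then \<tau> h $ c else 0)"
    "dim_vec (finsum_vec TYPE(real) d \<tau> {h. h < t \<and> P h}) = d" for P
  proof -
    have "finsum_vec TYPE(real) d \<tau> {h. h < t \<and> P h} $ c = (\<Sum>h\<in>{h. h < t \<and> P h}. \<tau> h $ c)"
      by (rule index_finsum_vec) (use \<tau> c in auto)
    also have "\<dots> = (\<Sum>h\<in>{h \<in> {..<t}. P h}. \<tau> h $ c)"
      by (rule sum.cong) auto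
    also have "\<dots> = (\<Sum>h<t. if P h then \<tau> h $ c else 0)"
      by (rule sum.inter_filter) simp
    finally show "finsum_vec TYPE(real) d \<tau> {h. h < t \<and> P h} $ c = (\<Sum>h<t. if P h then \<tau> h $ c else 0)" .
    have "finsum_vec TYPE(real) d \<tau> {h. h < t \<and> P h} \<in> carrier_vec d"
      by (rule finsum_vec_closed) (use \<tau> in auto)
    then show "dim_vec (finsum_vec TYPE(real) d \<tau> {h. h < t \<and> P h}) = d"
      by simp
  qed
  have "shift d \<tau> \<gamma> i $ c = (\<Sum>h<t. if snd i ! h = Some 0 \<and> \<gamma> ! h = 1 then \<tau> h $ c else 0) -
      (\<Sum>h<t. if snd i ! h = Some 1 \<and> \<gamma> ! h = 1 then \<tau> h $ c else 0)"
    using c by (simp add: shift_def len *)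
  also have "\<dots> = (\<Sum>h<t. shift_coeff (snd i ! h) (\<gamma> ! h) * \<tau> h $ c)"
    unfolding sum_subtractf [symmetric] by (rule sum.cong) (auto simp: shift_coeff_def)
  finally show ?thesis .
qed

lemma snoc_vec_index:
  "x \<in> carrier_vec d \<Longrightarrow> c < d + 1 \<Longrightarrow> snoc_vec x s $ c = (if c < d then x $ c else s)"
  by (auto simp: snoc_vec_def vec_of_list_index)

lemma hyp_block_index:
  assumes "shift d \<tau> \<gamma> i \<in> carrier_vec d" "c < d + 1" "c' < d + 1"
  shows "hyp_block d \<tau> \<gamma> i $$ (c, c') =
    (if c = c' then 1 else if c = d then - shift d \<tau> \<gamma> i $ c' else 0)"
proof -
  have "mat_of_rows d [- shift d \<tau> \<gamma> i] \<in> carrier_mat 1 d"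
    by (simp add: mat_of_rows_def)
  then show ?thesis
    using assms unfolding hyp_block_def
    by (subst index_mat_four_block) (auto simp: mat_of_rows_def)
qed

fun row_act :: "bit list \<Rightarrow> 'v evert row_label \<Rightarrow> 'v evert row_label" where
  "row_act \<gamma> (RowPP e) = RowPP (act \<gamma> ` e)"
| "row_act \<gamma> (RowPH e) = RowPH (act \<gamma> ` e)"
| "row_act \<gamma> (RowNpar e) = RowNpar (act \<gamma> ` e)"
| "row_act \<gamma> (RowPar e m) = RowPar (act \<gamma> ` e) m"
| "row_act \<gamma> (RowH k) = RowH (act \<gamma> k)"

fun row_sign :: "bit list \<Rightarrow> 'v evert row_label \<Rightarrow> real" where
  "row_sign \<gamma> (RowPP e) = edge_sign \<gamma> e"
| "row_sign \<gamma> (RowPar e m) = edge_sign \<gamma> e"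
| "row_sign \<gamma> _ = 1"

text \<open>All blocks of P'_E are signed permutations, so a single action and a single sign on row
  labels cover the five row types together.\<close>

lemma int_rep_entry_monomial:
  "int_rep_entry \<gamma> r s = (if r = row_act \<gamma> s then row_sign \<gamma> r else 0)"
  by (cases r; cases s) auto

text \<open>Matrix products become sums over label sets, which makes the arguments independent of
  how vertices and edges are listed.\<close>

definition cols_of :: "nat \<Rightarrow> 'v ph_graph \<Rightarrow> 'v col_label set" where
  "cols_of d G = (\<lambda>(i, c). ColP i c) ` (points G \<times> {..<d}) \<union> (\<lambda>(k, c). ColH k c) ` (hyps G \<times> {..<d + 1})"

definition rows_of :: "nat \<Rightarrow> 'v ph_graph \<Rightarrow> ('v \<Rightarrow> real vec) \<Rightarrow> 'v row_label set" where
  "rows_of d G a = RowPP ` edges_PP G \<union> RowPH ` edges_PH G \<union> RowNpar ` edges_HH_npar G a \<union>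
     (\<lambda>(e, m). RowPar e m) ` (edges_HH_par G a \<times> {..<d - 1}) \<union> RowH ` hyps G"

lemma distinct_concat_map:
  assumes "distinct xs" "distinct ys" "\<And>x y x' y'. f x y = f x' y' \<Longrightarrow> x = x' \<and> y = y'"
  shows "distinct (concat (map (\<lambda>x. map (f x) ys) xs))"
  using assms(1)
proof (induction xs)
  case (Cons x xs)
  have "inj_on (f x) (set ys)"
    using assms(3) by (meson inj_onI)
  then have "distinct (map (f x) ys)"
    using assms(2) by (simp add: distinct_map)
  moreover have "set (map (f x) ys) \<inter> set (concat (map (\<lambda>x. map (f x) ys) xs)) = {}"
    using Cons.prems assms(3) by fastforce
  ultimately show ?case
    using Cons by simp
qed simp

lemma col_labels:
  assumes "distinct ps" "set ps = points G" "distinct hs" "set hs = hyps G"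
  shows "distinct (col_labels d ps hs)" "set (col_labels d ps hs) = cols_of d G"
proof -
  show "distinct (col_labels d ps hs)"
    unfolding col_labels_def distinct_append
    by (intro conjI distinct_concat_map) (use assms in auto)
  show "set (col_labels d ps hs) = cols_of d G"
    unfolding col_labels_def cols_of_def using assms by (auto simp: image_iff)
qed

lemma row_labels:
  assumes "distinct pps" "set pps = edges_PP G" "distinct phs" "set phs = edges_PH G"
    "distinct npars" "set npars = edges_HH_npar G a" "distinct pars" "set pars = edges_HH_par G a"
    "distinct hs" "set hs = hyps G"
  shows "distinct (row_labels d pps phs npars pars hs)"
    "set (row_labels d pps phs npars pars hs) = rows_of d G a"
proof -
  have "distinct (concat (map (\<lambda>e. map (RowPar e) [0..<d - 1]) pars))"
    by (rule distinct_concat_map) (use assms in auto)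
  then show "distinct (row_labels d pps phs npars pars hs)"
    unfolding row_labels_def using assms by (auto simp: distinct_map inj_on_def)
  show "set (row_labels d pps phs npars pars hs) = rows_of d G a"
    unfolding row_labels_def rows_of_def using assms by (auto simp: image_iff)
qed

context extrusion
begin

lemma edge_types_subset:
  "e \<in> edges_PP G \<Longrightarrow> e \<in> edges G" "e \<in> edges_PH G \<Longrightarrow> e \<in> edges G"
  "e \<in> edges_HH G \<Longrightarrow> e \<in> edges G" "e \<in> edges_HH_par G a \<Longrightarrow> e \<in> edges_HH G"
  "e \<in> edges_HH_npar G a \<Longrightarrow> e \<in> edges_HH G"
  by (auto simp: edges_PP_def edges_PH_def edges_HH_def edges_HH_par_def edges_HH_npar_def)

lemma act_edge_types:
  assumes \<gamma>: "\<gamma> \<in> bits t"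
  shows "e \<in> edges_PP G \<Longrightarrow> act \<gamma> ` e \<in> edges_PP G" "e \<in> edges_PH G \<Longrightarrow> act \<gamma> ` e \<in> edges_PH G"
    "e \<in> edges_HH G \<Longrightarrow> act \<gamma> ` e \<in> edges_HH G"
proof -
  show "act \<gamma> ` e \<in> edges_PP G" if "e \<in> edges_PP G"
    using that act_edges [OF \<gamma>] act_points [OF \<gamma>] unfolding edges_PP_def by auto
  show "act \<gamma> ` e \<in> edges_PH G" if e: "e \<in> edges_PH G"
  proof -
    obtain i k where "i \<in> e" "i \<in> points G" "k \<in> e" "k \<in> hyps G"
      using e by (auto simp: edges_PH_def)
    then have "act \<gamma> i \<in> act \<gamma> ` e \<inter> points G" "act \<gamma> k \<in> act \<gamma> ` e \<inter> hyps G"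
      using act_points [OF \<gamma>] act_hyps [OF \<gamma>] by simp_all
    then show ?thesis
      using act_edges [OF \<gamma>] that unfolding edges_PH_def by blast
  qed
  show "act \<gamma> ` e \<in> edges_HH G" if "e \<in> edges_HH G"
    using that act_edges [OF \<gamma>] act_hyps [OF \<gamma>] unfolding edges_HH_def by auto
qed

lemma PH_other_end:
  assumes "e \<in> edges_PH G" "i \<in> e"
  shows "i \<in> points G \<Longrightarrow> other_end e i \<in> hyps G" "i \<in> hyps G \<Longrightarrow> other_end e i \<in> points G"
proof -
  note oe = other_end_card_2 [OF card_edge [OF edge_types_subset(2) [OF assms(1)]] assms(2)]
  have ne: "e \<inter> points G \<noteq> {}" "e \<inter> hyps G \<noteq> {}"
    using assms(1) by (auto simp: edges_PH_def)
  show "other_end e i \<in> hyps G" if "i \<in> points G"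
  proof -
    obtain k where "k \<in> e" "k \<in> hyps G"
      using ne(2) by blast
    moreover from this that have "k \<noteq> i"
      using points_hyps_disjoint by blast
    ultimately show ?thesis
      using oe(1) by (metis insertE singletonD)
  qed
  show "other_end e i \<in> points G" if "i \<in> hyps G"
  proof -
    obtain k where "k \<in> e" "k \<in> points G"
      using ne(1) by blast
    moreover from this that have "k \<noteq> i"
      using points_hyps_disjoint by blast
    ultimately show ?thesis
      using oe(1) by (metis insertE singletonD)
  qed
qed

text \<open>The ends of an extruded edge lie in one orbit and therefore have the same type.\<close>

lemma PH_not_extruded:
  assumes e: "e \<in> edges_PH G"
  shows "\<not> extruded_edge h e"
proof
  assume h: "extruded_edge h e"
  obtain i where i: "i \<in> e" "i \<in> points G"
    using e by (auto simp: edges_PH_def)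
  have "other_end e i = act (unit_bits t h) i"
    by (rule extruded_other_end(3) [OF edge_types_subset(2) [OF e] h i(1)])
  then have "other_end e i \<in> points G"
    using act_points [OF unit_bits_in_bits i(2)] by simp
  moreover have "other_end e i \<in> hyps G"
    by (rule PH_other_end(1) [OF e i])
  ultimately show False
    using points_hyps_disjoint by blast
qed

end

section \<open>The internal representation of a symmetric framework\<close>

locale symmetric_framework = extrusion t F H G
  for t :: nat and F :: "nat \<Rightarrow> 'v set" and H :: "'v ph_graph" and G :: "'v evert ph_graph" +
  fixes d :: nat and p a :: "'v evert \<Rightarrow> real vec" and r :: "'v evert \<Rightarrow> real"
    and \<tau> :: "nat \<Rightarrow> real vec"
    and tail :: "'v evert set \<Rightarrow> 'v evert" and \<alpha> :: "'v evert set \<Rightarrow> real vec list"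
  assumes framework: "ph_framework d G p a r"
    and symmetric: "extrusion_symmetric d t F G p a r \<tau>"
    and no_extrusion_direction:
      "\<And>i j h. i \<in> points G \<Longrightarrow> j \<in> hyps G \<Longrightarrow> {i, j} \<in> edges_PH G \<Longrightarrow> h < t \<Longrightarrow>
         \<not> hyperplane_contains (a j) (\<tau> h)"
    and convention: "parallel_convention d t G a tail \<alpha>"
begin

lemma p_carrier: "i \<in> points G \<Longrightarrow> p i \<in> carrier_vec d"
  and a_carrier: "k \<in> hyps G \<Longrightarrow> a k \<in> carrier_vec d"
  and a_nonzero: "k \<in> hyps G \<Longrightarrow> a k \<noteq> 0\<^sub>v d"
  using framework by (auto simp: ph_framework_def)

lemma \<tau>_carrier: "h < t \<Longrightarrow> \<tau> h \<in> carrier_vec d"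
  and p_act: "\<gamma> \<in> bits t \<Longrightarrow> i \<in> points G \<Longrightarrow> p (act \<gamma> i) = p i + shift d \<tau> \<gamma> i"
  and a_act: "\<gamma> \<in> bits t \<Longrightarrow> k \<in> hyps G \<Longrightarrow> a (act \<gamma> k) = a k"
  using symmetric by (auto simp: extrusion_symmetric_def)

lemma \<tau>_orthogonal: "k \<in> hyps G \<Longrightarrow> h < t \<Longrightarrow> fst k \<in> F h \<Longrightarrow> \<tau> h \<bullet> a k = 0"
  \<comment> \<open>The orthogonality condition stands under the quantifier over the group; a unit
    vector shows that the group is inhabited.\<close>
  using symmetric unfolding extrusion_symmetric_def
  by (meson unit_bits_in_bits)

lemma shift_carrier_vec: "\<gamma> \<in> bits t \<Longrightarrow> shift d \<tau> \<gamma> i \<in> carrier_vec d"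
  by (rule shift_carrier) (rule \<tau>_carrier)

lemma shift_nth:
  "\<gamma> \<in> bits t \<Longrightarrow> c < d \<Longrightarrow>
    shift d \<tau> \<gamma> i $ c = (\<Sum>h<t. shift_coeff (snd i ! h) (\<gamma> ! h) * \<tau> h $ c)"
  by (rule shift_index) (rule \<tau>_carrier)

text \<open>The translation vector sees only the bits and not the vertex of H; this is how the ends
  of an edge over distinct vertices can be moved alike.\<close>

lemma shift_cong:
  assumes "\<And>h. h < t \<Longrightarrow> snd i ! h = snd j ! h" and \<gamma>: "\<gamma> \<in> bits t"
  shows "shift d \<tau> \<gamma> i = shift d \<tau> \<gamma> j"
proof (rule eq_vecI)
  show "dim_vec (shift d \<tau> \<gamma> i) = dim_vec (shift d \<tau> \<gamma> j)"
    using shift_carrier_vec [OF \<gamma>] by (metis carrier_vecD)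
  fix c assume "c < dim_vec (shift d \<tau> \<gamma> j)"
  then have "c < d"
    using shift_carrier_vec [OF \<gamma>] by (metis carrier_vecD)
  then show "shift d \<tau> \<gamma> i $ c = shift d \<tau> \<gamma> j $ c"
    using assms(1) by (simp add: shift_nth [OF \<gamma>])
qed

lemma edges_HH_par_act:
  assumes \<gamma>: "\<gamma> \<in> bits t" and e: "e \<in> edges_HH_par G a"
  shows "act \<gamma> ` e \<in> edges_HH_par G a"
proof -
  have "k \<in> hyps G" if "k \<in> e" for k
    using e that by (auto simp: edges_HH_par_def edges_HH_def)
  then show ?thesis
    using e act_edge_types(3) [OF \<gamma>] a_act [OF \<gamma>] by (simp add: edges_HH_par_def)
qed

text \<open>If the image were parallel, applying the involution once more would make the original
  edge parallel.\<close>

lemma edges_HH_npar_act: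
  assumes \<gamma>: "\<gamma> \<in> bits t" and e: "e \<in> edges_HH_npar G a"
  shows "act \<gamma> ` e \<in> edges_HH_npar G a"
proof -
  have e': "e \<in> edges_HH G" "e \<in> edges G" "e \<notin> edges_HH_par G a"
    using e edge_types_subset by (auto simp: edges_HH_npar_def)
  have "act \<gamma> ` act \<gamma> ` e = e"
    using act_act_edge [OF e'(2) \<gamma> \<gamma>] act_zero_edge [OF e'(2)] \<gamma> by (simp add: add_bits_self bits_def)
  then have "act \<gamma> ` e \<notin> edges_HH_par G a"
    using edges_HH_par_act [OF \<gamma>, of "act \<gamma> ` e"] e'(3) by auto
  then show ?thesis
    using act_edge_types(3) [OF \<gamma> e'(1)] by (simp add: edges_HH_npar_def)
qed

lemma rows_cases [consumes 1, case_names PP PH Npar Par H]: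
  assumes "x \<in> rows_of d G a"
  obtains e where "x = RowPP e" "e \<in> edges_PP G" "e \<in> edges G"
  | e where "x = RowPH e" "e \<in> edges_PH G" "e \<in> edges G"
  | e where "x = RowNpar e" "e \<in> edges_HH_npar G a" "e \<in> edges_HH G" "e \<in> edges G"
  | e m where "x = RowPar e m" "e \<in> edges_HH_par G a" "m < d - 1" "e \<in> edges_HH G" "e \<in> edges G"
  | k where "x = RowH k" "k \<in> hyps G"
  using assms edge_types_subset unfolding rows_of_def by auto

lemma row_act_rows: "x \<in> rows_of d G a \<Longrightarrow> \<gamma> \<in> bits t \<Longrightarrow> row_act \<gamma> x \<in> rows_of d G a"
  by (cases x rule: rows_cases)
    (auto simp: rows_of_def act_edge_types edges_HH_par_act edges_HH_npar_act act_hyps)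

lemma row_act_act:
  "x \<in> rows_of d G a \<Longrightarrow> \<gamma> \<in> bits t \<Longrightarrow> \<delta> \<in> bits t \<Longrightarrow> row_act \<gamma> (row_act \<delta> x) = row_act (add_bits \<gamma> \<delta>) x"
  by (cases x rule: rows_cases)
    (simp_all add: act_act_edge act_act [OF length_snd_verts [OF hyps_in_verts]])

lemma row_act_zero: "x \<in> rows_of d G a \<Longrightarrow> row_act (replicate t 0) x = x"
  by (cases x rule: rows_cases)
    (simp_all add: act_zero_edge act_zero [OF length_snd_verts [OF hyps_in_verts]])

lemma row_act_involution: "x \<in> rows_of d G a \<Longrightarrow> \<gamma> \<in> bits t \<Longrightarrow> row_act \<gamma> (row_act \<gamma> x) = x"
  using row_act_act [of x \<gamma> \<gamma>] row_act_zero [of x] by (simp add: add_bits_self bits_def)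

lemma row_sign_act: "x \<in> rows_of d G a \<Longrightarrow> \<delta> \<in> bits t \<Longrightarrow> row_sign \<gamma> (row_act \<delta> x) = row_sign \<gamma> x"
  by (cases x rule: rows_cases) (simp_all add: edge_sign_act)

lemma row_sign_zero: "row_sign (replicate t 0) x = 1"
  by (cases x) (simp_all add: edge_sign_zero)

lemma row_sign_add:
  "x \<in> rows_of d G a \<Longrightarrow> \<gamma> \<in> bits t \<Longrightarrow> \<delta> \<in> bits t \<Longrightarrow>
    row_sign (add_bits \<gamma> \<delta>) x = row_sign \<gamma> x * row_sign \<delta> x"
  by (cases x rule: rows_cases) (simp_all add: edge_sign_add)

lemma int_rep_entry_eq:
  assumes "x \<in> rows_of d G a" "y \<in> rows_of d G a" "\<gamma> \<in> bits t"
  shows "int_rep_entry \<gamma> x y = (if y = row_act \<gamma> x then row_sign \<gamma> x else 0)"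
  using row_act_involution assms by (auto simp: int_rep_entry_monomial)

lemma int_rep_entry_sum:
  assumes "x \<in> rows_of d G a" "\<gamma> \<in> bits t" "finite (rows_of d G a)"
  shows "(\<Sum>y\<in>rows_of d G a. int_rep_entry \<gamma> x y * f y) = row_sign \<gamma> x * f (row_act \<gamma> x)"
proof -
  have "(\<Sum>y\<in>rows_of d G a. int_rep_entry \<gamma> x y * f y) =
      (\<Sum>y\<in>rows_of d G a. if y = row_act \<gamma> x then row_sign \<gamma> x * f y else 0)"
    by (rule sum.cong) (simp_all add: int_rep_entry_eq assms)
  then show ?thesis
    using assms row_act_rows [OF assms(1,2)] by simp
qed

lemma bits_rep_int:
  assumes "distinct rs" "set rs = rows_of d G a"
  shows "bits_rep t (length rs) (\<lambda>\<gamma>. mat_of_labels (int_rep_entry \<gamma>) rs rs)"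
proof -
  have fin: "finite (rows_of d G a)"
    using assms(2) by (metis finite_set)
  have "mat_of_labels (int_rep_entry (replicate t 0)) rs rs = mat_of_labels (\<lambda>r c. if r = c then 1 else 0) rs rs"
    by (rule mat_of_labels_cong) (simp add: int_rep_entry_monomial assms row_act_zero row_sign_zero)
  moreover have "mat_of_labels (int_rep_entry (add_bits \<gamma> \<delta>)) rs rs =
      mat_of_labels (int_rep_entry \<gamma>) rs rs * mat_of_labels (int_rep_entry \<delta>) rs rs"
    if "\<gamma> \<in> bits t" "\<delta> \<in> bits t" for \<gamma> \<delta>
    unfolding mat_of_labels_mult [OF assms(1)]
  proof (rule mat_of_labels_cong)
    fix x y assume "x \<in> set rs" "y \<in> set rs"
    then have xy: "x \<in> rows_of d G a" "y \<in> rows_of d G a"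
      using assms(2) by simp_all
    \<comment> \<open>Following a row through the product applies \<gamma> before \<delta>, opposite
      to the order in \<open>row_act_act\<close>; the group is commutative.\<close>
    have "row_act \<delta> (row_act \<gamma> x) = row_act (add_bits \<gamma> \<delta>) x"
      using row_act_act [OF xy(1) that(2,1)] by (simp add: add_bits_commute)
    then show "int_rep_entry (add_bits \<gamma> \<delta>) x y =
        (\<Sum>z\<in>set rs. int_rep_entry \<gamma> x z * int_rep_entry \<delta> z y)"
      unfolding assms(2) int_rep_entry_sum [OF xy(1) that(1) fin]
      using xy that row_act_rows [OF xy(1) that(1)]
      by (simp add: int_rep_entry_eq row_sign_add row_sign_act)
  qed
  ultimately show ?thesis
    unfolding bits_rep_def using mat_of_labels_one [OF assms(1)] by simp
qed

text \<open>The permutation is an involution, and an edge and its image carry the same sign.\<close>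

lemma int_rep_symmetric:
  assumes "set rs = rows_of d G a" "\<gamma> \<in> bits t"
  shows "(mat_of_labels (int_rep_entry \<gamma>) rs rs)\<^sup>T = mat_of_labels (int_rep_entry \<gamma>) rs rs"
  unfolding mat_of_labels_transpose
proof (rule mat_of_labels_cong)
  fix x y assume "x \<in> set rs" "y \<in> set rs"
  then have xy: "x \<in> rows_of d G a" "y \<in> rows_of d G a"
    using assms(1) by simp_all
  show "int_rep_entry \<gamma> y x = int_rep_entry \<gamma> x y"
    using xy assms(2) row_sign_act [OF xy(2) assms(2), of \<gamma>]
    by (auto simp: int_rep_entry_eq [OF xy assms(2)] int_rep_entry_monomial [of \<gamma> y x] row_sign_act)
qed

section \<open>The external representation: permutations with shears\<close>

lemma cols_cases [consumes 1, case_names P H]: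
  assumes "x \<in> cols_of d G"
  obtains i c where "x = ColP i c" "i \<in> points G" "c < d"
  | k c where "x = ColH k c" "k \<in> hyps G" "c < d + 1"
  using assms unfolding cols_of_def by auto

lemma ColP_in_cols: "ColP i c \<in> cols_of d G \<longleftrightarrow> i \<in> points G \<and> c < d"
  and ColH_in_cols: "ColH k c \<in> cols_of d G \<longleftrightarrow> k \<in> hyps G \<and> c < d + 1"
  unfolding cols_of_def by auto

lemma ext_rep_entry_ColH:
  assumes "\<gamma> \<in> bits t" "c < d + 1" "c' < d + 1"
  shows "ext_rep_entry d \<tau> \<gamma> (ColH i c) (ColH j c') =
    (if i = act \<gamma> j then if c = c' then 1 else if c = d then - shift d \<tau> \<gamma> i $ c' else 0 else 0)"
  unfolding ext_rep_entry.simps hyp_block_index [OF shift_carrier_vec [OF assms(1)] assms(2,3)] by (rule refl)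

lemma ext_rep_entry_sum_P:
  assumes "\<gamma> \<in> bits t" "i \<in> points G" "c < d" "finite (cols_of d G)"
  shows "(\<Sum>x\<in>cols_of d G. f x * ext_rep_entry d \<tau> \<gamma> x (ColP i c)) = f (ColP (act \<gamma> i) c)"
proof -
  have "(\<Sum>x\<in>cols_of d G. f x * ext_rep_entry d \<tau> \<gamma> x (ColP i c)) =
      (\<Sum>x\<in>cols_of d G. if x = ColP (act \<gamma> i) c then f x else 0)"
  proof (rule sum.cong)
    fix x show "f x * ext_rep_entry d \<tau> \<gamma> x (ColP i c) = (if x = ColP (act \<gamma> i) c then f x else 0)"
      by (cases x) auto
  qed simp
  then show ?thesis
    using assms act_points by (simp add: ColP_in_cols)
qed

text \<open>Besides the permutation entry, a normal coordinate c < d meets one shear entry, in the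
  row of the offset variable. The shear is based at the image vertex \<open>act \<gamma> k\<close>,
  since the block at (i, j) is defined with the translation of i.\<close>

lemma ext_rep_entry_sum_H:
  assumes \<gamma>: "\<gamma> \<in> bits t" and k: "k \<in> hyps G" and c: "c < d + 1" and fin: "finite (cols_of d G)"
  shows "(\<Sum>x\<in>cols_of d G. f x * ext_rep_entry d \<tau> \<gamma> x (ColH k c)) =
    f (ColH (act \<gamma> k) c) -
    (if c < d then f (ColH (act \<gamma> k) d) * shift d \<tau> \<gamma> (act \<gamma> k) $ c else 0)"
proof -
  let ?s = "shift d \<tau> \<gamma> (act \<gamma> k) $ c"
  \<comment> \<open>For c = d both indicators select the same label; the guard c < d then switches
    off the shear term.\<close>
  have "(\<Sum>x\<in>cols_of d G. f x * ext_rep_entry d \<tau> \<gamma> x (ColH k c)) =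
      (\<Sum>x\<in>cols_of d G. (if x = ColH (act \<gamma> k) c then f x else 0) -
        (if x = ColH (act \<gamma> k) d then if c < d then f x * ?s else 0 else 0))"
  proof (rule sum.cong)
    fix x assume "x \<in> cols_of d G"
    then show "f x * ext_rep_entry d \<tau> \<gamma> x (ColH k c) = (if x = ColH (act \<gamma> k) c then f x else 0) -
        (if x = ColH (act \<gamma> k) d then if c < d then f x * ?s else 0 else 0)"
    proof (cases rule: cols_cases)
      case (H k' c')
      then show ?thesis
        using ext_rep_entry_ColH [OF \<gamma> H(3) c, of k' k] c by (auto simp del: ext_rep_entry.simps)
    qed simp
  qed simp
  also have "\<dots> = f (ColH (act \<gamma> k) c) - (if c < d then f (ColH (act \<gamma> k) d) * ?s else 0)"
    using act_hyps [OF \<gamma> k] c fin by (simp add: sum_subtractf ColH_in_cols)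
  finally show ?thesis .
qed

lemma shift_zero: "c < d \<Longrightarrow> shift d \<tau> (replicate t 0) i $ c = 0"
  using shift_nth [of "replicate t 0" c i] by (simp add: bits_def)

text \<open>Cocycle identity: move i by \<delta>, then its image by \<gamma>. It makes the shears
  compose.\<close>

lemma shift_add:
  assumes "\<gamma> \<in> bits t" "\<delta> \<in> bits t" "length (snd i) = t" "c < d"
  shows "shift d \<tau> (add_bits \<gamma> \<delta>) i $ c = shift d \<tau> \<delta> i $ c + shift d \<tau> \<gamma> (act \<delta> i) $ c"
proof -
  have "shift_coeff (snd i ! h) (add_bits \<gamma> \<delta> ! h) =
      shift_coeff (snd i ! h) (\<delta> ! h) + shift_coeff (snd (act \<delta> i) ! h) (\<gamma> ! h)" if "h < t" for h
    using that assms(1-3) shift_coeff_add [of "snd i ! h" "\<gamma> ! h" "\<delta> ! h"] by (simp add: bits_def)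
  then show ?thesis
    using assms by (simp add: shift_nth sum.distrib [symmetric] distrib_right [symmetric])
qed

lemma bits_rep_ext:
  assumes "distinct cs" "set cs = cols_of d G"
  shows "bits_rep t (length cs) (\<lambda>\<gamma>. mat_of_labels (ext_rep_entry d \<tau> \<gamma>) cs cs)"
proof -
  have fin: "finite (cols_of d G)"
    using assms(2) by (metis finite_set)
  have "mat_of_labels (ext_rep_entry d \<tau> (replicate t 0)) cs cs = mat_of_labels (\<lambda>r c. if r = c then 1 else 0) cs cs"
  proof (rule mat_of_labels_cong)
    fix x y assume "x \<in> set cs" "y \<in> set cs"
    then have xy: "x \<in> cols_of d G" "y \<in> cols_of d G"
      using assms(2) by simp_all
    have z: "replicate t 0 \<in> bits t"
      by (simp add: bits_def)
    from xy(2) show "ext_rep_entry d \<tau> (replicate t 0) x y = (if x = y then 1 else 0)"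
    proof (cases rule: cols_cases)
      case (P j c)
      then show ?thesis
        by (cases x) (auto simp: act_zero [OF length_snd_verts [OF points_in_verts]])
    next
      case (H j c')
      from xy(1) show ?thesis
      proof (cases rule: cols_cases)
        case (H i c)
        then show ?thesis
          using ext_rep_entry_ColH [OF z H(3), of c' i j] \<open>y = ColH j c'\<close> \<open>j \<in> hyps G\<close> \<open>c' < d + 1\<close>
          by (auto simp: act_zero [OF length_snd_verts [OF hyps_in_verts]] shift_zero simp del: ext_rep_entry.simps)
      qed (simp add: \<open>y = ColH j c'\<close>)
    qed
  qed
  moreover have "mat_of_labels (ext_rep_entry d \<tau> (add_bits \<gamma> \<delta>)) cs cs =
      mat_of_labels (ext_rep_entry d \<tau> \<gamma>) cs cs * mat_of_labels (ext_rep_entry d \<tau> \<delta>) cs cs"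
    if \<gamma>: "\<gamma> \<in> bits t" and \<delta>: "\<delta> \<in> bits t" for \<gamma> \<delta>
    unfolding mat_of_labels_mult [OF assms(1)] assms(2)
  proof (rule mat_of_labels_cong)
    fix x y assume "x \<in> set cs" "y \<in> set cs"
    then have xy: "x \<in> cols_of d G" "y \<in> cols_of d G"
      using assms(2) by simp_all
    from xy(2) show "ext_rep_entry d \<tau> (add_bits \<gamma> \<delta>) x y =
        (\<Sum>z\<in>cols_of d G. ext_rep_entry d \<tau> \<gamma> x z * ext_rep_entry d \<tau> \<delta> z y)"
    proof (cases rule: cols_cases)
      case (P j c)
      show ?thesis
        unfolding P(1) ext_rep_entry_sum_P [OF \<delta> P(2,3) fin]
        using act_act [OF length_snd_verts [OF points_in_verts [OF P(2)]] \<gamma> \<delta>]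
        by (cases x) auto
    next
      case (H j c')
      note jH = H
      have act_j: "act \<gamma> (act \<delta> j) = act (add_bits \<gamma> \<delta>) j"
        by (rule act_act [OF length_snd_verts [OF hyps_in_verts [OF jH(2)]] \<gamma> \<delta>])
      show ?thesis
        unfolding jH(1) ext_rep_entry_sum_H [OF \<delta> jH(2,3) fin]
        using xy(1)
      proof (cases rule: cols_cases)
        case (H i c)
        have gd: "add_bits \<gamma> \<delta> \<in> bits t"
          using \<gamma> \<delta> by simp
        \<comment> \<open>The two shears are based at i and at \<gamma>i = \<delta>j, so the cocycle
          identity is used along the path from i through \<delta>j back to j.\<close>
        have "shift d \<tau> (add_bits \<gamma> \<delta>) i $ c' = shift d \<tau> \<gamma> i $ c' + shift d \<tau> \<delta> (act \<delta> j) $ c'"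
          if "i = act (add_bits \<gamma> \<delta>) j" "c' < d"
        proof -
          have "act \<gamma> i = act \<delta> j"
            using that(1) act_j act_act_verts [OF act_verts [OF \<delta> hyps_in_verts [OF jH(2)]] \<gamma>] by metis
          then show ?thesis
            using shift_add [OF \<delta> \<gamma> length_snd_verts [OF hyps_in_verts [OF H(2)]] that(2)]
            by (simp add: add_bits_commute)
        qed
        then show "ext_rep_entry d \<tau> (add_bits \<gamma> \<delta>) x (ColH j c') =
          ext_rep_entry d \<tau> \<gamma> x (ColH (act \<delta> j) c') -
          (if c' < d then ext_rep_entry d \<tau> \<gamma> x (ColH (act \<delta> j) d) * shift d \<tau> \<delta> (act \<delta> j) $ c' else 0)"
          unfolding H(1)
          by (subst (1 2 3) ext_rep_entry_ColH)
            (use H(3) jH(3) gd \<gamma> act_j in \<open>auto simp del: ext_rep_entry.simps\<close>)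
      qed simp
    qed
  qed
  ultimately show ?thesis
    unfolding bits_rep_def using mat_of_labels_one [OF assms(1)] by simp
qed

end

section \<open>Equivariance of the rigidity matrix\<close>

context symmetric_framework
begin

text \<open>Along an extruded edge the difference of the ends is \<tau>_h up to sign, and it is
  reversed exactly when \<gamma>_h = 1. Along any other edge the ends, having no stars, carry the
  same bits and move by the same vector.\<close>

lemma PP_edge_act:
  assumes e: "e \<in> edges_PP G" and i: "i \<in> e" and \<gamma>: "\<gamma> \<in> bits t" and c: "c < d"
  shows "edge_sign \<gamma> e * (p (act \<gamma> i) - p (act \<gamma> (other_end e i))) $ c = (p i - p (other_end e i)) $ c"
proof -
  let ?l = "other_end e i"
  note eG = edge_types_subset(1) [OF e]
  have pts: "i \<in> points G" "?l \<in> points G"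
    using e i other_end_in_edge [OF eG i] by (auto simp: edges_PP_def)
  note carr = p_carrier [THEN carrier_vecD]
  show ?thesis
  proof (cases "\<exists>h. extruded_edge h e")
    case True
    then obtain h where h: "extruded_edge h e" ..
    note ex = extruded_other_end [OF eG h i]
    have diff: "(p j - p (act (unit_bits t h) j)) $ c = - (shift_coeff (snd j ! h) 1 * \<tau> h $ c)"
      if j: "j \<in> points G" for j
    proof -
      have "shift d \<tau> (unit_bits t h) j $ c =
          (\<Sum>g<t. if g = h then shift_coeff (snd j ! h) 1 * \<tau> h $ c else 0)"
        unfolding shift_nth [OF unit_bits_in_bits c]
        by (rule sum.cong) (simp_all add: nth_unit_bits)
      then have "shift d \<tau> (unit_bits t h) j $ c = shift_coeff (snd j ! h) 1 * \<tau> h $ c"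
        using ex(1) by simp
      then show ?thesis
        using c carr [OF j] shift_carrier_vec [OF unit_bits_in_bits, of h j]
        by (simp add: p_act [OF unit_bits_in_bits j])
    qed
    have "act \<gamma> ?l = act (unit_bits t h) (act \<gamma> i)"
      using act_act [OF length_snd_verts [OF points_in_verts [OF pts(1)]]] \<gamma>
      by (simp add: ex(3) add_bits_commute)
    then have "(p (act \<gamma> i) - p (act \<gamma> ?l)) $ c = - (shift_coeff (snd (act \<gamma> i) ! h) 1 * \<tau> h $ c)"
      using diff [OF act_points [OF \<gamma> pts(1)]] by simp
    also have "snd (act \<gamma> i) ! h = map_option (\<lambda>b. b + \<gamma> ! h) (snd i ! h)"
      using ex(1) \<gamma> length_snd_verts [OF points_in_verts [OF pts(1)]] by (simp add: bits_def)
    finally show ?thesis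
      using diff [OF pts(1)] ex(3)
      by (simp add: edge_sign_extruded [OF eG h \<gamma>] shift_coeff_flip [OF ex(2)])
  next
    case False
    then have "snd ?l ! h = snd i ! h" if "h < t" for h
      using not_extruded_edge(2) [OF eG _ i that] no_star_points [OF _ that] pts by blast
    then have "shift d \<tau> \<gamma> ?l = shift d \<tau> \<gamma> i"
      by (rule shift_cong [OF _ \<gamma>])
    then show ?thesis
      using False c carr [OF pts(1)] carr [OF pts(2)] shift_carrier_vec [OF \<gamma>, of i]
      by (simp add: edge_sign_not_extruded p_act [OF \<gamma> pts(1)] p_act [OF \<gamma> pts(2)])
  qed
qed

text \<open>A star at \<open>h\<close> in the hyperplane \<open>k\<close> would put $\tau_h$ into that hyperplane. Hence both ends of
  a point-hyperplane edge are shifted by the same vector.\<close>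

lemma PH_edge_shift:
  assumes e: "e \<in> edges_PH G" and k: "k \<in> e" "k \<in> hyps G" and \<gamma>: "\<gamma> \<in> bits t"
  shows "shift d \<tau> \<gamma> (other_end e k) = shift d \<tau> \<gamma> k"
proof (rule shift_cong [OF _ \<gamma>])
  fix h assume h: "h < t"
  note eG = edge_types_subset(2) [OF e]
  have i: "other_end e k \<in> points G"
    by (rule PH_other_end(2) [OF e k])
  have "{other_end e k, k} = e"
    using other_end_card_2(1) [OF card_edge [OF eG] k(1)] by (simp add: insert_commute)
  then have "\<not> hyperplane_contains (a k) (\<tau> h)"
    using no_extrusion_direction [OF i k(2) _ h] e by simp
  then have "fst k \<notin> F h"
    using \<tau>_orthogonal [OF k(2) h] comm_scalar_prod [OF a_carrier [OF k(2)] \<tau>_carrier [OF h]]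
    by (auto simp: hyperplane_contains_def)
  then have "snd k ! h \<noteq> None"
    using star_iff [OF hyps_in_verts [OF k(2)] h] by simp
  then show "snd (other_end e k) ! h = snd k ! h"
    using not_extruded_edge(2) [OF eG PH_not_extruded [OF e] k(1) h] no_star_points [OF i h] by simp
qed

text \<open>On an extruded edge the tail has bit 0 at h, so \<gamma> exchanges tail and head exactly
  when \<gamma>_h = 1; the normals agree because the ends share an orbit. On other edges the tail
  lies over a fixed vertex of H throughout the orbit, so \<gamma> carries tail to tail.\<close>

lemma tail_act:
  assumes e: "e \<in> edges_HH_par G a" and \<gamma>: "\<gamma> \<in> bits t"
  shows "tail (act \<gamma> ` e) = act \<gamma> (tail e) \<and> edge_sign \<gamma> e = 1 \<or>
    tail (act \<gamma> ` e) = act \<gamma> (other_end e (tail e)) \<and> edge_sign \<gamma> e = -1 \<and>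
    a (other_end e (tail e)) = a (tail e)"
proof -
  let ?k = "tail e" and ?l = "other_end e (tail e)"
  note eH = edge_types_subset(4) [OF e]
  note eG = edge_types_subset(3) [OF eH]
  note ge = edges_HH_par_act [OF \<gamma> e]
  have k: "?k \<in> e"
    using convention e by (simp add: parallel_convention_def)
  have kH: "?k \<in> hyps G"
    using eH k by (auto simp: edges_HH_def)
  note oe = other_end_card_2 [OF card_edge [OF eG] k]
  have "tail (act \<gamma> ` e) \<in> act \<gamma> ` e"
    using convention ge by (simp add: parallel_convention_def)
  then have tail: "tail (act \<gamma> ` e) = act \<gamma> ?k \<or> tail (act \<gamma> ` e) = act \<gamma> ?l"
    using arg_cong [OF oe(1), of "image (act \<gamma>)"] by auto
  show ?thesis
  proof (cases "\<exists>h. extruded_edge h e")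
    case True
    then obtain h where h: "extruded_edge h e" ..
    note ex = extruded_other_end [OF eG h k]
    have "extruded_edge h (act \<gamma> ` e)"
      using h extruded_edge_act [OF eG \<gamma>] by simp
    then have zero: "snd ?k ! h = Some 0" "snd (tail (act \<gamma> ` e)) ! h = Some 0"
      using convention e ge h ex(1) by (auto simp: parallel_convention_def)
    have len: "length (snd ?k) = t" "length (snd ?l) = t"
      using length_snd_edge [OF eG] k other_end_in_edge [OF eG k] by auto
    have "snd ?l ! h = Some 1"
      using ex(1,3) zero(1) len by (simp add: nth_unit_bits unit_bits_def)
    then have "snd (act \<gamma> ?k) ! h = Some (\<gamma> ! h)" "snd (act \<gamma> ?l) ! h = Some (1 + \<gamma> ! h)"
      using ex(1) zero(1) len \<gamma> by (simp_all add: bits_def)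
    then have "if \<gamma> ! h = 1 then tail (act \<gamma> ` e) = act \<gamma> ?l else tail (act \<gamma> ` e) = act \<gamma> ?k"
      using tail zero(2) by (cases "\<gamma> ! h") auto
    moreover have "a ?l = a ?k"
      using a_act [OF unit_bits_in_bits kH] by (simp add: ex(3))
    ultimately show ?thesis
      by (simp add: edge_sign_extruded [OF eG h \<gamma>] split: if_splits)
  next
    case False
    have "card (fst ` e) = 2"
      using not_extruded_edge(1) [OF eG _ k] False by blast
    moreover from this have "fst (tail (act \<gamma> ` e)) = fst ?k"
      using convention e \<gamma> by (simp add: parallel_convention_def)
    moreover have "fst ` e = {fst ?k, fst ?l}"
      using arg_cong [OF oe(1), of "image fst"] by simp
    ultimately have "tail (act \<gamma> ` e) \<noteq> act \<gamma> ?l"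
      by (auto simp: card_insert_if split: if_splits)
    then show ?thesis
      using tail False by (simp add: edge_sign_not_extruded)
  qed
qed

abbreviation entry :: "'v evert row_label \<Rightarrow> 'v evert col_label \<Rightarrow> real" where
  "entry \<equiv> rigidity_entry p a tail \<alpha>"

text \<open>Since \<gamma> is an involution, i meets the image edge iff \<gamma>i meets the edge.
  Entries then agree by invariance of the normals or, between points, thanks to the edge
  sign.\<close>

lemma entry_act_ColP:
  assumes x: "x \<in> rows_of d G a" and i: "i \<in> points G" and c: "c < d" and \<gamma>: "\<gamma> \<in> bits t"
  shows "row_sign \<gamma> x * entry (row_act \<gamma> x) (ColP i c) = entry x (ColP (act \<gamma> i) c)"
proof -
  note iV = points_in_verts [OF i]
  have inv: "act \<gamma> (act \<gamma> i) = i"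
    by (rule act_act_verts [OF iV \<gamma>])
  have oe: "other_end (act \<gamma> ` e) i = act \<gamma> (other_end e (act \<gamma> i))"
    if "e \<in> edges G" "act \<gamma> i \<in> e" for e
    using other_end_act [OF that(1) \<gamma> that(2)] by (simp add: inv)
  from x show ?thesis
  proof (cases rule: rows_cases)
    case (PP e)
    then show ?thesis
      using mem_act_edge_iff [OF PP(3) \<gamma> iV] PP_edge_act [OF PP(2) _ \<gamma> c, of "act \<gamma> i"] oe [OF PP(3)]
      by (simp add: inv)
  next
    case (PH e)
    have "a (act \<gamma> (other_end e (act \<gamma> i))) = a (other_end e (act \<gamma> i))" if "act \<gamma> i \<in> e"
      by (rule a_act [OF \<gamma> PH_other_end(1) [OF PH(2) that act_points [OF \<gamma> i]]])
    then show ?thesis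
      using mem_act_edge_iff [OF PH(3) \<gamma> iV] oe [OF PH(3)] PH(1) by simp
  qed simp_all
qed

text \<open>If the tail is preserved, factor and basis vectors are unchanged along the orbit. If the
  ends are exchanged, the factor is 1, the entries \<alpha>_m and -\<alpha>_m trade places, and the
  edge sign undoes this.\<close>

lemma entry_act_ColH_par:
  assumes e: "e \<in> edges_HH_par G a" and m: "m < d - 1" and k: "k \<in> hyps G" and \<gamma>: "\<gamma> \<in> bits t"
    and c: "c < d + 1"
  shows "edge_sign \<gamma> e * entry (RowPar (act \<gamma> ` e) m) (ColH k c) = entry (RowPar e m) (ColH (act \<gamma> k) c)"
proof -
  let ?k = "tail e" and ?l = "other_end e (tail e)"
  note eH = edge_types_subset(4) [OF e]
  note eG = edge_types_subset(3) [OF eH]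
  have te: "?k \<in> e"
    using convention e by (simp add: parallel_convention_def)
  note oe = other_end_card_2 [OF card_edge [OF eG] te]
  have hyps: "?k \<in> hyps G" "?l \<in> hyps G"
    using eH te other_end_in_edge [OF eG te] by (auto simp: edges_HH_def)
  have \<alpha>: "\<alpha> (act \<gamma> ` e) = \<alpha> e"
    using convention e \<gamma> by (simp add: parallel_convention_def)
  have "\<alpha> e ! m \<in> set (\<alpha> e)" "set (\<alpha> e) \<subseteq> carrier_vec d"
    using convention e m by (auto simp: parallel_convention_def basis_of_def)
  then have \<alpha>m: "\<alpha> e ! m \<in> carrier_vec d"
    by blast
  have act_eq: "k = act \<gamma> j \<longleftrightarrow> act \<gamma> k = j" if "j \<in> hyps G" for j
    using act_act_verts [OF hyps_in_verts \<gamma>] that k by metis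
  have oe_act: "other_end (act \<gamma> ` e) (act \<gamma> ?k) = act \<gamma> ?l"
    by (rule other_end_act [OF eG \<gamma> te])
  have oe_l: "other_end e ?l = ?k"
    by (rule other_end_eqI) (use oe in \<open>auto simp: insert_commute\<close>)
  have oe_act': "other_end (act \<gamma> ` e) (act \<gamma> ?l) = act \<gamma> ?k"
    using other_end_act [OF eG \<gamma> other_end_in_edge [OF eG te]] by (simp add: oe_l)
  have a: "a (act \<gamma> ?k) = a ?k" "a (act \<gamma> ?l) = a ?l"
    using a_act [OF \<gamma>] hyps by simp_all
  have neg: "- snoc_vec (- (\<alpha> e ! m)) 0 $ c = snoc_vec (\<alpha> e ! m) 0 $ c"
    using c \<alpha>m by (simp add: snoc_vec_index)
  from tail_act [OF e \<gamma>] show ?thesis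
  proof (elim disjE conjE)
    assume "tail (act \<gamma> ` e) = act \<gamma> ?k" "edge_sign \<gamma> e = 1"
    then show ?thesis
      by (simp add: Let_def oe_act act_eq hyps \<alpha> a par_factor_def)
  next
    assume t: "tail (act \<gamma> ` e) = act \<gamma> ?l" "edge_sign \<gamma> e = -1" "a ?l = a ?k"
    \<comment> \<open>The scalar behind \<open>THE\<close> in \<open>par_factor\<close> is unique
      because the normal has a nonzero coordinate.\<close>
    have "c' = 1" if "a ?k = c' \<cdot>\<^sub>v a ?k" for c'
    proof -
      obtain g where g: "g < d" "a ?k $ g \<noteq> 0"
        using a_nonzero [OF hyps(1)] a_carrier [OF hyps(1)] by (metis carrier_vecD eq_vecI index_zero_vec)
      have "a ?k $ g = c' * a ?k $ g"
        using arg_cong [OF that, of "\<lambda>v. v $ g"] g(1) a_carrier [OF hyps(1)] by simp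
      then show ?thesis
        using g(2) by simp
    qed
    then have "(THE c'. a ?k = c' \<cdot>\<^sub>v a ?k) = 1"
      by (intro the_equality) auto
    then have factor: "par_factor a ?k ?l = 1" "par_factor a (act \<gamma> ?l) (act \<gamma> ?k) = 1"
      using t(3) a by (simp_all add: par_factor_def)
    show ?thesis
      using t(1,2) oe(2) neg by (auto simp: Let_def oe_act' act_eq hyps \<alpha> factor)
  qed
qed

lemma entry_act_ColH:
  assumes x: "x \<in> rows_of d G a" and k: "k \<in> hyps G" and c: "c < d + 1" and \<gamma>: "\<gamma> \<in> bits t"
  shows "row_sign \<gamma> x * entry (row_act \<gamma> x) (ColH k c) =
    entry x (ColH (act \<gamma> k) c) -
    (if c < d then entry x (ColH (act \<gamma> k) d) * shift d \<tau> \<gamma> (act \<gamma> k) $ c else 0)"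
proof -
  note kV = hyps_in_verts [OF k]
  let ?k = "act \<gamma> k"
  have k': "?k \<in> hyps G"
    by (rule act_hyps [OF \<gamma> k])
  have inv: "act \<gamma> ?k = k"
    by (rule act_act_verts [OF kV \<gamma>])
  have oe: "other_end (act \<gamma> ` e) k = act \<gamma> (other_end e ?k)" if "e \<in> edges G" "?k \<in> e" for e
    using other_end_act [OF that(1) \<gamma> that(2)] by (simp add: inv)
  from x show ?thesis
  proof (cases rule: rows_cases)
    case (PP e)
    then show ?thesis by simp
  next
    case (PH e)
    show ?thesis
    proof (cases "?k \<in> e")
      case True
      let ?i = "other_end e ?k"
      have i: "?i \<in> points G"
        by (rule PH_other_end(2) [OF PH(2) True k'])
      \<comment> \<open>The offset entry of this row is -1, so subtracting its multiple of the
        translation adds that vector to the point, giving the point's image.\<close>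
      have "p (act \<gamma> ?i) = p ?i + shift d \<tau> \<gamma> ?k"
        using p_act [OF \<gamma> i] PH_edge_shift [OF PH(2) True k' \<gamma>] by simp
      then show ?thesis
        using True mem_act_edge_iff [OF PH(3) \<gamma> kV] oe [OF PH(3) True] PH(1) c
          p_carrier [OF i] shift_carrier_vec [OF \<gamma>, of ?k]
        by (simp add: snoc_vec_index [where d = d])
    next
      case False
      then show ?thesis
        using mem_act_edge_iff [OF PH(3) \<gamma> kV] PH(1) by simp
    qed
  next
    case (Npar e)
    show ?thesis
    proof (cases "?k \<in> e")
      case True
      have l: "other_end e ?k \<in> hyps G"
        using other_end_in_edge [OF Npar(4) True] Npar(3) by (auto simp: edges_HH_def)
      then show ?thesis
        using True mem_act_edge_iff [OF Npar(4) \<gamma> kV] oe [OF Npar(4) True] Npar(1) c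
          a_act [OF \<gamma> l] a_carrier [OF l]
        by (simp add: snoc_vec_index)
    next
      case False
      then show ?thesis
        using mem_act_edge_iff [OF Npar(4) \<gamma> kV] Npar(1) by simp
    qed
  next
    case (Par e m)
    have "\<alpha> e ! m \<in> set (\<alpha> e)" "set (\<alpha> e) \<subseteq> carrier_vec d"
      using convention Par(2,3) by (auto simp: parallel_convention_def basis_of_def)
    then have "\<alpha> e ! m \<in> carrier_vec d"
      by blast
    \<comment> \<open>A parallel row is 0 in the offset column, so the shear contributes
      nothing.\<close>
    then have "entry (RowPar e m) (ColH ?k d) = 0"
      by (simp add: Let_def snoc_vec_index)
    then show ?thesis
      using entry_act_ColH_par [OF Par(2,3) k \<gamma> c] Par(1) by (simp del: rigidity_entry.simps)
  next
    case (H l)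
    have "k = act \<gamma> l \<longleftrightarrow> ?k = l"
      using act_act_verts [OF hyps_in_verts \<gamma>] H(2) inv by metis
    then show ?thesis
      using H c a_act [OF \<gamma> H(2)] a_carrier [OF H(2)] by (simp add: snoc_vec_index)
  qed
qed

text \<open>Both products collapse: the left one to the image row with its sign, the right one to
  the image column corrected by the shear.\<close>

lemma rigidity_equivariant:
  assumes rs: "distinct rs" "set rs = rows_of d G a" and cs: "distinct cs" "set cs = cols_of d G"
    and \<gamma>: "\<gamma> \<in> bits t"
  shows "mat_of_labels (int_rep_entry \<gamma>) rs rs * mat_of_labels entry rs cs =
    mat_of_labels entry rs cs * mat_of_labels (ext_rep_entry d \<tau> \<gamma>) cs cs"
  unfolding mat_of_labels_mult [OF rs(1)] mat_of_labels_mult [OF cs(1)] rs(2) cs(2)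
proof (rule mat_of_labels_cong)
  fix x y assume "x \<in> set rs" "y \<in> set cs"
  then have x: "x \<in> rows_of d G a" and y: "y \<in> cols_of d G"
    using rs(2) cs(2) by simp_all
  have fin: "finite (rows_of d G a)" "finite (cols_of d G)"
    using rs(2) cs(2) by (metis finite_set)+
  show "(\<Sum>z\<in>rows_of d G a. int_rep_entry \<gamma> x z * entry z y) =
      (\<Sum>z\<in>cols_of d G. entry x z * ext_rep_entry d \<tau> \<gamma> z y)"
    unfolding int_rep_entry_sum [OF x \<gamma> fin(1)]
    using y
  proof (cases rule: cols_cases)
    case (P i c)
    then show "row_sign \<gamma> x * entry (row_act \<gamma> x) y =
        (\<Sum>z\<in>cols_of d G. entry x z * ext_rep_entry d \<tau> \<gamma> z y)"
      unfolding P(1) ext_rep_entry_sum_P [OF \<gamma> P(2,3) fin(2)]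
      by (intro entry_act_ColP [OF x _ _ \<gamma>])
  next
    case (H k c)
    then show "row_sign \<gamma> x * entry (row_act \<gamma> x) y =
        (\<Sum>z\<in>cols_of d G. entry x z * ext_rep_entry d \<tau> \<gamma> z y)"
      unfolding H(1) ext_rep_entry_sum_H [OF \<gamma> H(2,3) fin(2)]
      by (intro entry_act_ColH [OF x _ _ \<gamma>])
  qed
qed

end

theorem corollary3p4:
  fixes d t :: nat
    and H :: "'v ph_graph" and F :: "nat \<Rightarrow> 'v set" and G :: "'v evert ph_graph"
    and p a :: "'v evert \<Rightarrow> real vec" and r :: "'v evert \<Rightarrow> real"
    and \<tau> :: "nat \<Rightarrow> real vec"
    and tail :: "'v evert set \<Rightarrow> 'v evert" and \<alpha> :: "'v evert set \<Rightarrow> real vec list"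
    and ps hs :: "'v evert list" and pps phs npars pars :: "'v evert set list"
    and \<rho> :: "nat \<Rightarrow> bit list \<Rightarrow> real"
  assumes "ph_graph H" and "t \<ge> 1" and "\<And>h. h < t \<Longrightarrow> F h \<subseteq> hyps H"
    and "G = extrusion_graph t F H"
    and "ph_framework d G p a r"
    and "extrusion_symmetric d t F G p a r \<tau>"
    and "\<And>i j h. i \<in> points G \<Longrightarrow> j \<in> hyps G \<Longrightarrow> {i, j} \<in> edges_PH G \<Longrightarrow> h < t \<Longrightarrow>
           \<not> hyperplane_contains (a j) (\<tau> h)"
    \<comment> \<open>choices made in writing down the matrices\<close>
    and "parallel_convention d t G a tail \<alpha>"
    and "distinct ps" "set ps = points G"
    and "distinct hs" "set hs = hyps G"
    and "distinct pps" "set pps = edges_PP G"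
    and "distinct phs" "set phs = edges_PH G"
    and "distinct npars" "set npars = edges_HH_npar G a"
    and "distinct pars" "set pars = edges_HH_par G a"
    and "bij_betw \<rho> {..<2 ^ t} (irrep t ` bits t)"
  defines "cs \<equiv> col_labels d ps hs"
    and "rs \<equiv> row_labels d pps phs npars pars hs"
  defines "R \<equiv> mat_of_labels (rigidity_entry p a tail \<alpha>) rs cs"
    and "PV \<equiv> (\<lambda>\<gamma>. mat_of_labels (ext_rep_entry d \<tau> \<gamma>) cs cs)"
    and "PE \<equiv> (\<lambda>\<gamma>. mat_of_labels (int_rep_entry \<gamma>) rs rs)"
  shows "\<exists>A B.
     A \<in> carrier_mat (length cs) (length cs) \<and> invertible_mat A \<and>
     B \<in> carrier_mat (length rs) (length rs) \<and> invertible_mat B \<and>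
     (\<exists>(bX :: nat \<Rightarrow> real vec list) (bY :: nat \<Rightarrow> real vec list) (Rt :: nat \<Rightarrow> real mat).
        cols A = concat (map bX [0..<2 ^ t]) \<and>
        cols B = concat (map bY [0..<2 ^ t]) \<and>
        (\<forall>\<kappa><2 ^ t.
           basis_of (length cs) (isotypic t (length cs) PV (\<rho> \<kappa>)) (bX \<kappa>) \<and>
           basis_of (length rs) (isotypic t (length rs) PE (\<rho> \<kappa>)) (bY \<kappa>) \<and>
           Rt \<kappa> \<in> carrier_mat (length (bY \<kappa>)) (length (bX \<kappa>))) \<and>
        B\<^sup>T * R * A = diag_block_mat (map Rt [0..<2 ^ t]))"
proof -
  interpret symmetric_framework t F H G d p a r \<tau> tail \<alpha>
    by unfold_locales (fact assms)+
  \<comment> \<open>The listings of vertices and edges enter only as enumerations of the label sets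
    \<open>rows_of\<close> and \<open>cols_of\<close>.\<close>
  have rs: "distinct rs" "set rs = rows_of d G a"
    unfolding rs_def by (rule row_labels [OF assms(13-20,11,12)])+
  have cs: "distinct cs" "set cs = cols_of d G"
    unfolding cs_def by (rule col_labels [OF assms(9-12)])+
  show ?thesis
  proof (rule equivariant_block_diagonalization)
    show "bits_rep t (length cs) PV"
      unfolding PV_def by (rule bits_rep_ext [OF cs])
    show "bits_rep t (length rs) PE"
      unfolding PE_def by (rule bits_rep_int [OF rs])
    show "R \<in> carrier_mat (length rs) (length cs)"
      unfolding R_def by simp
    show "PE \<gamma> * R = R * PV \<gamma>" if "\<gamma> \<in> bits t" for \<gamma>
      unfolding PE_def R_def PV_def by (rule rigidity_equivariant [OF rs cs that])
    show "(PE \<gamma>)\<^sup>T = PE \<gamma>" if "\<gamma> \<in> bits t" for \<gamma>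
      unfolding PE_def by (rule int_rep_symmetric [OF rs(2) that])
    show "bij_betw \<rho> {..<2 ^ t} (irrep t ` bits t)"
      by fact
  qed
qed

end
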